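(* Let $(\mathcal A,\mathcal G,\alpha)$ be a dynamical system with $\mathcal A$ unital. Let $\phi:\mathcal G\to B(H)$ be a unital, strongly continuous, completely positive definite map and let $\rho:\mathcal A\to B(H)$ be a unital completely contractive map satisfying $$\phi(s)\rho(a)=\rho(\alpha_s(a))\phi(s)\quad\text{for all } s\in\mathcal G,\ a\in\mathcal A.$$ Then there exist a Hilbert space $K\supseteq H$, a strongly continuous unitary representation $\hat\phi:\mathcal G\to B(K)$ and a completely contractive map $\hat\rho:\mathcal A\to B(K)$ such that, with $P$ the orthogonal projection of $K$ onto $H$, $$\rho(a)=P\hat\rho(a)|_H,\qquad \phi(s)=P\hat\phi(s)|_H,\qquad \hat\phi(s)\hat\rho(a)=\hat\rho(\alpha_s(a))\hat\phi(s)$$ for all $a\in\mathcal A$, $s\in\mathcal G$. Furthermore $H$ reduces $\hat\rho(\mathcal A)$, and if $\rho$ is multiplicative then $\hat\rho$ is multiplicative as well.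
   Context: A dynamical system $(\mathcal A,\mathcal G,\alpha)$ consists of an operator algebra $\mathcal A$ (norm-closed subalgebra of some $B(H)$), a locally compact Hausdorff group $\mathcal G$, and a group homomorphism $\alpha:\mathcal G\to\mathrm{Aut}(\mathcal A)$ into the completely isometric automorphisms of $\mathcal A$, continuous in the point-norm topology. A map $\phi:\mathcal G\to B(H)$ is completely positive definite if for every finite set $s_1,\dots,s_n\in\mathcal G$ the operator matrix $(\phi(s_i^{-1}s_j))_{i,j}$ is positive; it is unital if $\phi(e)=I$. *)

theory Defs
  imports "HOL-Analysis.Analysis"
begin

text \<open>A complex Hilbert space is a real Hilbert space (real inner product, complete)
  together with a complex structure imult (multiplication by i), which is
  real-linear, squares to minus the identity and preserves the real inner product.
  The complex inner product is then cinner x y = (x . y) + i (x . imult y),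
  linear in the first and conjugate-linear in the second variable.\<close>

class complex_hilbert = real_inner + complete_space +
  fixes imult :: "'a \<Rightarrow> 'a"
  assumes imult_add: "imult (x + y) = imult x + imult y"
    and imult_scaleR: "imult (r *\<^sub>R x) = r *\<^sub>R imult x"
    and imult_imult: "imult (imult x) = - x"
    and imult_inner: "inner (imult x) (imult y) = inner x y"

definition scaleC :: "complex \<Rightarrow> 'a::complex_hilbert \<Rightarrow> 'a" where
  "scaleC c x = Re c *\<^sub>R x + Im c *\<^sub>R imult x"

definition cinner :: "'a::complex_hilbert \<Rightarrow> 'a \<Rightarrow> complex" where
  "cinner x y = complex_of_real (inner x y) + \<i> * complex_of_real (inner x (imult y))"

definition cpos :: "complex \<Rightarrow> bool" where
  "cpos z \<longleftrightarrow> Im z = 0 \<and> 0 \<le> Re z"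

definition bop :: "('a::complex_hilbert \<Rightarrow> 'b::complex_hilbert) \<Rightarrow> bool" where
  "bop T \<longleftrightarrow> bounded_linear T \<and> (\<forall>x. T (imult x) = imult (T x))"

definition is_adjoint :: "('a::complex_hilbert \<Rightarrow> 'b::complex_hilbert) \<Rightarrow> ('b \<Rightarrow> 'a) \<Rightarrow> bool" where
  "is_adjoint T S \<longleftrightarrow> (\<forall>x y. inner (T x) y = inner x (S y))"

definition adj :: "('a::complex_hilbert \<Rightarrow> 'b::complex_hilbert) \<Rightarrow> ('b \<Rightarrow> 'a)" where
  "adj T = (THE S. is_adjoint T S)"

definition isometry :: "('a::complex_hilbert \<Rightarrow> 'b::complex_hilbert) \<Rightarrow> bool" where
  "isometry V \<longleftrightarrow> bop V \<and> (\<forall>x. norm (V x) = norm x)"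

definition unitary :: "('a::complex_hilbert \<Rightarrow> 'a) \<Rightarrow> bool" where
  "unitary U \<longleftrightarrow> isometry U \<and> surj U"

text \<open>Identifying H with the range of the isometry V : H \<rightarrow> K, the projection of K onto H
  is P = V V*, and the compression P T|_H is V* T V.\<close>
definition compress :: "('h::complex_hilbert \<Rightarrow> 'k::complex_hilbert) \<Rightarrow> ('k \<Rightarrow> 'k) \<Rightarrow> ('h \<Rightarrow> 'h)" where
  "compress V T = adj V \<circ> T \<circ> V"

definition reduces :: "('h::complex_hilbert \<Rightarrow> 'k::complex_hilbert) \<Rightarrow> ('k \<Rightarrow> 'k) \<Rightarrow> bool" where
  "reduces V T \<longleftrightarrow> (V \<circ> adj V) \<circ> T = T \<circ> (V \<circ> adj V)"

definition mnorm :: "nat \<Rightarrow> (nat \<Rightarrow> nat \<Rightarrow> 'a::real_normed_vector \<Rightarrow> 'b::real_normed_vector) \<Rightarrow> real" where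
  "mnorm n T = (SUP h \<in> {h::nat \<Rightarrow> 'a. (\<Sum>j<n. (norm (h j))\<^sup>2) \<le> 1}.
                   sqrt (\<Sum>i<n. (norm (\<Sum>j<n. T i j (h j)))\<^sup>2))"

definition operator_algebra :: "('a::complex_hilbert \<Rightarrow> 'a) set \<Rightarrow> bool" where
  "operator_algebra A \<longleftrightarrow>
     (\<forall>T\<in>A. bop T) \<and> (\<lambda>x. 0) \<in> A \<and>
     (\<forall>S\<in>A. \<forall>T\<in>A. (\<lambda>x. S x + T x) \<in> A \<and> S \<circ> T \<in> A) \<and>
     (\<forall>c. \<forall>T\<in>A. (\<lambda>x. scaleC c (T x)) \<in> A) \<and>
     (\<forall>X T. (\<forall>n. X n \<in> A) \<and> bop T \<and> (\<lambda>n. onorm (\<lambda>x. X n x - T x)) \<longlonglongrightarrow> 0 \<longrightarrow> T \<in> A)"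

definition linear_on :: "('a::complex_hilbert \<Rightarrow> 'a) set \<Rightarrow> (('a \<Rightarrow> 'a) \<Rightarrow> ('b::complex_hilbert \<Rightarrow> 'b)) \<Rightarrow> bool" where
  "linear_on A \<rho> \<longleftrightarrow>
     (\<forall>a\<in>A. \<forall>b\<in>A. \<rho> (\<lambda>x. a x + b x) = (\<lambda>x. \<rho> a x + \<rho> b x)) \<and>
     (\<forall>c. \<forall>a\<in>A. \<rho> (\<lambda>x. scaleC c (a x)) = (\<lambda>x. scaleC c (\<rho> a x)))"

definition multiplicative_on :: "('a \<Rightarrow> 'a) set \<Rightarrow> (('a \<Rightarrow> 'a) \<Rightarrow> ('b \<Rightarrow> 'b)) \<Rightarrow> bool" where
  "multiplicative_on A \<rho> \<longleftrightarrow> (\<forall>a\<in>A. \<forall>b\<in>A. \<rho> (a \<circ> b) = \<rho> a \<circ> \<rho> b)"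

definition ccontractive :: "('a::complex_hilbert \<Rightarrow> 'a) set \<Rightarrow> (('a \<Rightarrow> 'a) \<Rightarrow> ('b::complex_hilbert \<Rightarrow> 'b)) \<Rightarrow> bool" where
  "ccontractive A \<rho> \<longleftrightarrow> (\<forall>a\<in>A. bop (\<rho> a)) \<and> linear_on A \<rho> \<and>
     (\<forall>n a. (\<forall>i<n. \<forall>j<n. a i j \<in> A) \<longrightarrow> mnorm n (\<lambda>i j. \<rho> (a i j)) \<le> mnorm n a)"

definition ci_automorphism :: "('a::complex_hilbert \<Rightarrow> 'a) set \<Rightarrow> (('a \<Rightarrow> 'a) \<Rightarrow> ('a \<Rightarrow> 'a)) \<Rightarrow> bool" where
  "ci_automorphism A \<beta> \<longleftrightarrow> bij_betw \<beta> A A \<and> linear_on A \<beta> \<and> multiplicative_on A \<beta> \<and>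
     (\<forall>n a. (\<forall>i<n. \<forall>j<n. a i j \<in> A) \<longrightarrow> mnorm n (\<lambda>i j. \<beta> (a i j)) = mnorm n a)"

text \<open>Locally compact Hausdorff topological group (written additively; not necessarily
  commutative: s^{-1} t is - s + t).\<close>
definition lc_group :: "'g::{group_add, t2_space} itself \<Rightarrow> bool" where
  "lc_group _ \<longleftrightarrow>
     continuous_on UNIV (\<lambda>p::'g \<times> 'g. fst p + snd p) \<and>
     continuous_on UNIV (uminus :: 'g \<Rightarrow> 'g) \<and>
     locally_compact_space (euclidean :: 'g topology)"

definition dynamical_system :: "('a::complex_hilbert \<Rightarrow> 'a) set \<Rightarrow> ('g::{group_add, t2_space} \<Rightarrow> ('a \<Rightarrow> 'a) \<Rightarrow> ('a \<Rightarrow> 'a)) \<Rightarrow> bool" where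
  "dynamical_system A \<alpha> \<longleftrightarrow> operator_algebra A \<and>
     (\<forall>s. ci_automorphism A (\<alpha> s)) \<and>
     (\<forall>s t. \<forall>a\<in>A. \<alpha> (s + t) a = \<alpha> s (\<alpha> t a)) \<and>
     (\<forall>a\<in>A. \<alpha> 0 a = a) \<and>
     (\<forall>a\<in>A. \<forall>s0. \<forall>e>0. \<exists>U. open U \<and> s0 \<in> U \<and>
         (\<forall>s\<in>U. onorm (\<lambda>x. \<alpha> s a x - \<alpha> s0 a x) < e))"

definition strongly_continuous :: "('g::topological_space \<Rightarrow> 'h::complex_hilbert \<Rightarrow> 'h) \<Rightarrow> bool" where
  "strongly_continuous \<phi> \<longleftrightarrow> (\<forall>h. continuous_on UNIV (\<lambda>s. \<phi> s h))"

definition cpd :: "('g::group_add \<Rightarrow> 'h::complex_hilbert \<Rightarrow> 'h) \<Rightarrow> bool" where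
  "cpd \<phi> \<longleftrightarrow> (\<forall>n (s::nat \<Rightarrow> 'g) (h::nat \<Rightarrow> 'h).
      cpos (\<Sum>i<n. \<Sum>j<n. cinner (\<phi> (- s i + s j) (h j)) (h i)))"

definition unitary_rep :: "('g::group_add \<Rightarrow> 'k::complex_hilbert \<Rightarrow> 'k) \<Rightarrow> bool" where
  "unitary_rep \<pi> \<longleftrightarrow> (\<forall>s. unitary (\<pi> s)) \<and> (\<forall>s t. \<pi> (s + t) = \<pi> s \<circ> \<pi> t) \<and> \<pi> 0 = id"

definition orthonormal_family :: "('i \<Rightarrow> 'k::complex_hilbert) \<Rightarrow> bool" where
  "orthonormal_family e \<longleftrightarrow> (\<forall>p q. cinner (e p) (e q) = (if p = q then 1 else 0))"

end

theory Submission
  imports Defs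
begin

text \<open>A positive definite \<open>\<phi>\<close> is dilated in the usual way: vectors W s h with
  \<open>\<langle>W t x, W s y\<rangle> = \<langle>\<phi>(s\<^sup>-\<^sup>1 t) x, y\<rangle>\<close> are found inside K, H is embedded by W at the neutral element, and
  the unitaries translate the first argument of W. On the closed span of the W s h the operator
  \<open>\<rho>'(a)\<close> sends W s h to W s (\<open>\<rho>(\<alpha>\<^sub>s\<^sup>-\<^sup>1(a)) h\<close>); on the orthogonal complement the unitaries are the
  identity and \<open>\<rho>'\<close> is zero. The covariance relation says that the Gram operator of \<open>\<phi>\<close> commutes with
  the block diagonal operators built from \<open>\<rho>(\<alpha>\<^sub>s\<^sup>-\<^sup>1(a))\<close>, and an operator that commutes with a
  positive one is bounded for the associated seminorm by its original norm. This gives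
  well-definedness and complete contractivity of \<open>\<rho>'\<close> at once.\<close>

subsection \<open>Complex Hilbert spaces\<close>

text \<open>The space K is a type given in advance, so it is not built as a completion:
  \<open>room\<close> grants one orthonormal vector per pair in G x H, and a family with the
  prescribed Gram matrix has to be found inside K. That family need not span K, which is where the
  orthogonal complement comes from; taking \<open>\<rho>'\<close> to be zero there respects the
  bound, covariance and products alike. The contraction estimate is the real difficulty. A vector of
  the span has many expressions as a sum of the W s h, and its norm is governed by the Gram operator
  \<open>\<Phi>\<close>, not by the plain l2 norm of the coefficients, where the bound is known. In
  place of a square root of \<open>\<Phi>\<close>, the estimate iterates \<open>D\<^sup>* D\<close>:
  a crude comparison of the two norms is enough, because its constant does not depend on the number
  of iterations.\<close>

lemma linear_imult: "linear imult"
  by (rule linearI) (simp_all add: imult_add imult_scaleR)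

lemma norm_imult [simp]: "norm (imult x) = norm x"
  by (simp add: norm_eq_sqrt_inner imult_inner)

lemma bounded_linear_imult: "bounded_linear imult"
  by (intro bounded_linear_intro[where K=1]) (simp_all add: imult_add imult_scaleR)

lemmas imult_0 [simp] = linear_0[OF linear_imult]
lemmas imult_sum = linear_sum[OF linear_imult]

text \<open>An isometry whose square is minus the identity is skew: apply \<open>imult_inner\<close>
  to \<open>imult x\<close> and y.\<close>

lemma inner_imult_left: "inner (imult x) y = - inner x (imult y)"
  by (metis imult_imult imult_inner inner_minus_right minus_equation_iff)

lemma inner_imult_self [simp]: "inner x (imult x) = 0"
  using inner_imult_left[of x x] by (simp add: inner_commute)

lemma bop_linear: "bop T \<Longrightarrow> bounded_linear T"
  by (simp add: bop_def)

lemma bop_scaleC: "bop T \<Longrightarrow> T (scaleC c x) = scaleC c (T x)"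
  by (simp add: bop_def scaleC_def bounded_linear.linear linear_add linear_scale)

lemma bounded_linear_scaleC: "bounded_linear (scaleC c)"
  unfolding scaleC_def
  by (intro bounded_linear_add bounded_linear_compose[OF bounded_linear_scaleR_right]
      bounded_linear_ident bounded_linear_imult)

lemma bop_scaleC_fun: "bop T \<Longrightarrow> bop (\<lambda>x. scaleC c (T x))"
  using bounded_linear_compose[OF bounded_linear_scaleC, of T c]
  by (auto simp: bop_def scaleC_def imult_add imult_scaleR)

lemma bop_comp: "bop S \<Longrightarrow> bop T \<Longrightarrow> bop (S \<circ> T)"
  by (simp add: bop_def bounded_linear_compose comp_def)

lemma bop_id: "bop id"
  by (simp add: bop_def id_def bounded_linear_ident)

lemma Re_cinner [simp]: "Re (cinner x y) = inner x y"
  and Im_cinner [simp]: "Im (cinner x y) = inner x (imult y)"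
  by (simp_all add: cinner_def)

lemma cinner_add_left: "cinner (x + y) z = cinner x z + cinner y z"
  and cinner_add_right: "cinner z (x + y) = cinner z x + cinner z y"
  by (simp_all add: complex_eq_iff inner_add_left inner_add_right imult_add)

lemma cinner_zero [simp]: "cinner 0 z = 0" "cinner z 0 = 0"
  by (simp_all add: complex_eq_iff)

lemma cinner_commute: "cinner y x = cnj (cinner x y)"
  by (simp add: complex_eq_iff inner_commute inner_imult_left[of y x, symmetric])
     (metis add.inverse_inverse inner_commute inner_imult_left)

lemma cinner_scaleC_left: "cinner (scaleC c x) y = c * cinner x y"
  by (simp add: complex_eq_iff scaleC_def inner_add_left inner_imult_left imult_imult)

lemma cinner_scaleC_right: "cinner x (scaleC c y) = cnj c * cinner x y"
  by (subst (1 2) cinner_commute) (simp add: cinner_scaleC_left)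

lemma cinner_sum_left: "cinner (sum f F) y = (\<Sum>i\<in>F. cinner (f i) y)"
  by (induction F rule: infinite_finite_induct) (simp_all add: cinner_add_left)

lemma cinner_sum_right: "cinner y (sum f F) = (\<Sum>i\<in>F. cinner y (f i))"
  by (induction F rule: infinite_finite_induct) (simp_all add: cinner_add_right)

lemma cinner_self: "cinner x x = complex_of_real ((norm x)\<^sup>2)"
  by (simp add: complex_eq_iff dot_square_norm)

subsection \<open>Riesz representation\<close>

text \<open>The functional is given by its graph, so that it need not be well defined beforehand.\<close>
lemma riesz_graph:
  fixes \<Gamma> :: "('x::{real_inner,complete_space} \<times> real) set"
  assumes \<Gamma>: "subspace \<Gamma>" and C: "0 \<le> C"
    and bound: "\<And>x r. (x, r) \<in> \<Gamma> \<Longrightarrow> \<bar>r\<bar> \<le> C * norm x"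
  obtains v where "v \<in> closure (fst ` \<Gamma>)" "norm v \<le> C" "\<And>x r. (x, r) \<in> \<Gamma> \<Longrightarrow> inner x v = r"
proof -
  \<comment> \<open>The representing vector minimises the functional J.\<close>
  define J where "J p = (norm (fst p))\<^sup>2 - 2 * snd p" for p :: "'x \<times> real"
  define m where "m = Inf (J ` \<Gamma>)"
  have zero: "(0, 0) \<in> \<Gamma>"
    using subspace_0[OF \<Gamma>] by (simp add: zero_prod_def)
  have "- C\<^sup>2 \<le> J p" if "p \<in> \<Gamma>" for p
  proof -
    have "\<bar>snd p\<bar> \<le> C * norm (fst p)"
      using bound that by (metis prod.collapse)
    moreover have "0 \<le> (norm (fst p) - C)\<^sup>2" by simp
    ultimately show ?thesis unfolding J_def power2_diff by (simp add: field_simps)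
  qed
  then have bdd: "bdd_below (J ` \<Gamma>)"
    by (intro bdd_belowI[of _ "- C\<^sup>2"]) blast
  have m_le: "m \<le> J p" if "p \<in> \<Gamma>" for p
    unfolding m_def using bdd that by (auto intro: cInf_lower)
  have "\<exists>p\<in>\<Gamma>. J p < m + inverse (Suc n)" for n
    using cInf_lessD[of "J ` \<Gamma>" "m + inverse (Suc n)"] zero unfolding m_def by auto
  then obtain p where p: "\<And>n. p n \<in> \<Gamma>" "\<And>n. J (p n) < m + inverse (Suc n)"
    by metis
  have lim0: "(\<lambda>n. inverse (real (Suc n))) \<longlonglongrightarrow> 0"
    by (rule LIMSEQ_inverse_real_of_nat)
  \<comment> \<open>Parallelogram law for two near-minimisers: the linear part of J cancels, and J
    at the midpoint is at least m.\<close>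
  have close: "(norm (fst (p n) - fst (p k)))\<^sup>2 \<le> 2 * inverse (Suc n) + 2 * inverse (Suc k)" for n k
  proof -
    let ?q = "(1/2) *\<^sub>R (p n + p k)"
    have q: "?q \<in> \<Gamma>"
      by (intro subspace_scale[OF \<Gamma>] subspace_add[OF \<Gamma>] p)
    have "(norm (fst (p n) - fst (p k)))\<^sup>2 = 2 * J (p n) + 2 * J (p k) - 4 * J ?q"
      unfolding J_def
      by (simp add: power2_norm_eq_inner inner_simps power_divide algebra_simps inner_commute)
    with m_le[OF q] p(2)[of n] p(2)[of k] show ?thesis by linarith
  qed
  have "Cauchy (\<lambda>n. fst (p n))"
  proof (rule metric_CauchyI)
    fix e :: real assume e: "0 < e"
    then have "eventually (\<lambda>n. inverse (real (Suc n)) < e\<^sup>2 / 4) sequentially"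
      by (intro order_tendstoD[OF lim0]) simp
    then obtain M where M: "\<And>n. n \<ge> M \<Longrightarrow> inverse (real (Suc n)) < e\<^sup>2 / 4"
      by (auto simp: eventually_sequentially)
    have "dist (fst (p n)) (fst (p k)) < e" if "n \<ge> M" "k \<ge> M" for n k
    proof -
      have "(norm (fst (p n) - fst (p k)))\<^sup>2 < e\<^sup>2"
        using close[of n k] M[OF that(1)] M[OF that(2)] by linarith
      with e show ?thesis by (simp add: dist_norm power2_less_imp_less)
    qed
    then show "\<exists>M. \<forall>n\<ge>M. \<forall>k\<ge>M. dist (fst (p n)) (fst (p k)) < e" by blast
  qed
  then obtain v where v: "(\<lambda>n. fst (p n)) \<longlonglongrightarrow> v"
    using Cauchy_convergent convergent_def by blast
  have repr: "inner x v = r" if xr: "(x, r) \<in> \<Gamma>" for x r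
  proof -
    \<comment> \<open>Perturbing \<open>p n\<close> by t times (x, r) cannot push J below m. In the
      limit the slack vanishes and a nonnegative quadratic in t remains.\<close>
    have var: "0 \<le> 2 * t * (inner v x - r) + t\<^sup>2 * (norm x)\<^sup>2" for t
    proof (rule LIMSEQ_le)
      show "(\<lambda>n. - inverse (real (Suc n))) \<longlonglongrightarrow> 0"
        using tendsto_minus[OF lim0] by simp
      show "(\<lambda>n. 2 * t * (inner (fst (p n)) x - r) + t\<^sup>2 * (norm x)\<^sup>2) \<longlonglongrightarrow>
          2 * t * (inner v x - r) + t\<^sup>2 * (norm x)\<^sup>2"
        by (intro tendsto_intros v)
      have "- inverse (real (Suc n)) \<le> 2 * t * (inner (fst (p n)) x - r) + t\<^sup>2 * (norm x)\<^sup>2" for n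
      proof -
        have "p n + t *\<^sub>R (x, r) \<in> \<Gamma>"
          by (intro subspace_scale[OF \<Gamma>] subspace_add[OF \<Gamma>] p xr)
        from m_le[OF this] p(2)[of n] show ?thesis
          unfolding J_def power2_norm_eq_inner
          by (simp add: inner_simps algebra_simps inner_commute power2_eq_square)
      qed
      then show "\<exists>N. \<forall>n\<ge>N. - inverse (real (Suc n)) \<le> 2 * t * (inner (fst (p n)) x - r) + t\<^sup>2 * (norm x)\<^sup>2"
        by blast
    qed
    define d where "d = inner v x - r"
    have "d = 0"
    proof (cases "norm x = 0")
      case True
      then show ?thesis using var[of 1] var[of "-1"] d_def by simp
    next
      case False
      \<comment> \<open>This t is the vertex of the quadratic; its value there, - d^2 / |x|^2, can
        be nonnegative only if d = 0.\<close>
      have "0 \<le> 2 * (- d / (norm x)\<^sup>2) * d + (- d / (norm x)\<^sup>2)\<^sup>2 * (norm x)\<^sup>2"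
        using var[of "- d / (norm x)\<^sup>2"] d_def by simp
      also have "\<dots> = - (d\<^sup>2 / (norm x)\<^sup>2)"
        using False by (simp add: field_simps power2_eq_square)
      finally show ?thesis using False by (simp add: divide_le_0_iff)
    qed
    then show ?thesis by (simp add: d_def inner_commute)
  qed
  have "(norm v)\<^sup>2 \<le> C * norm v"
  proof (rule LIMSEQ_le)
    show "(\<lambda>n. inner (fst (p n)) v) \<longlonglongrightarrow> (norm v)\<^sup>2"
      unfolding power2_norm_eq_inner by (intro tendsto_intros v)
    show "(\<lambda>n. C * norm (fst (p n))) \<longlonglongrightarrow> C * norm v"
      by (intro tendsto_intros v)
    have "inner (fst (p n)) v \<le> C * norm (fst (p n))" for n
      using repr[of "fst (p n)" "snd (p n)"] bound[of "fst (p n)" "snd (p n)"] p(1)[of n] by simp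
    then show "\<exists>N. \<forall>n\<ge>N. inner (fst (p n)) v \<le> C * norm (fst (p n))" by blast
  qed
  then have "norm v \<le> C"
    using C by (cases "norm v = 0") (simp_all add: power2_eq_square)
  moreover have "v \<in> closure (fst ` \<Gamma>)"
    unfolding closure_sequential using v p(1) by (intro exI[of _ "\<lambda>n. fst (p n)"]) simp
  ultimately show ?thesis using repr that by blast
qed

text \<open>Riesz for the functional p -> <p, x> on S. As S need not be closed, the projection of x
  lies only in its closure.\<close>

lemma orthogonal_projection:
  fixes S :: "'x::{real_inner,complete_space} set"
  assumes S: "subspace S"
  obtains v where "v \<in> closure S" "\<And>p. p \<in> S \<Longrightarrow> inner p (x - v) = 0"
proof -
  define \<Gamma> where "\<Gamma> = (\<lambda>p. (p, inner p x)) ` S"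
  have "linear (\<lambda>p. (p, inner p x))"
    by (rule linearI) (simp_all add: inner_add_left)
  then have "subspace \<Gamma>"
    unfolding \<Gamma>_def using S by (rule linear_subspace_image)
  moreover have "\<bar>r\<bar> \<le> norm x * norm p" if "(p, r) \<in> \<Gamma>" for p r
    using that Cauchy_Schwarz_ineq2[of p x] by (auto simp: \<Gamma>_def mult.commute)
  ultimately obtain v where v: "v \<in> closure (fst ` \<Gamma>)"
      "\<And>p r. (p, r) \<in> \<Gamma> \<Longrightarrow> inner p v = r"
    using riesz_graph[of \<Gamma> "norm x"] by (metis norm_ge_zero)
  moreover have "fst ` \<Gamma> = S" by (auto simp: \<Gamma>_def image_image)
  moreover have "inner p v = inner p x" if "p \<in> S" for p
    using that by (intro v(2)) (simp add: \<Gamma>_def)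
  ultimately show ?thesis
    by (intro that[of v]) (simp_all add: inner_diff_right)
qed

lemma is_adjoint_adj:
  fixes T :: "'a::complex_hilbert \<Rightarrow> 'b::complex_hilbert"
  assumes T: "bounded_linear T"
  shows "is_adjoint T (adj T)"
proof -
  interpret T: bounded_linear T by (rule T)
  obtain M where M: "0 \<le> M" "\<And>x. norm (T x) \<le> norm x * M"
    using T.nonneg_bounded by blast
  have "\<exists>v. \<forall>x. inner (T x) y = inner x v" for y
  proof -
    define \<Gamma> where "\<Gamma> = range (\<lambda>x. (x, inner (T x) y))"
    have "linear (\<lambda>x. (x, inner (T x) y))"
      by (rule linearI) (simp_all add: inner_add_left T.add T.scaleR)
    then have "subspace \<Gamma>"
      unfolding \<Gamma>_def using subspace_UNIV by (rule linear_subspace_image)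
    moreover have "\<bar>r\<bar> \<le> (M * norm y) * norm x" if "(x, r) \<in> \<Gamma>" for x r
    proof -
      have "\<bar>r\<bar> \<le> norm (T x) * norm y"
        using that Cauchy_Schwarz_ineq2[of "T x" y] by (auto simp: \<Gamma>_def)
      also have "\<dots> \<le> norm x * M * norm y"
        by (intro mult_right_mono M) simp
      finally show ?thesis by (simp add: mult_ac)
    qed
    moreover have "0 \<le> M * norm y" using M by simp
    ultimately obtain v where "\<And>x r. (x, r) \<in> \<Gamma> \<Longrightarrow> inner x v = r"
      using riesz_graph by metis
    then show ?thesis by (metis \<Gamma>_def rangeI)
  qed
  then obtain S where S: "is_adjoint T S"
    unfolding is_adjoint_def by metis
  have "S' = S" if "is_adjoint T S'" for S'
  proof
    fix y
    have "inner x (S' y - S y) = 0" for x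
      using S that by (simp add: is_adjoint_def inner_diff_right)
    then show "S' y = S y" by (metis inner_eq_zero_iff right_minus_eq)
  qed
  with S show ?thesis unfolding adj_def by (rule theI)
qed

lemma inner_adj: "bounded_linear T \<Longrightarrow> inner x (adj T y) = inner (T x) y"
  using is_adjoint_adj by (metis is_adjoint_def)

lemma inner_left_eqI: "(\<And>z. inner z x = inner z y) \<Longrightarrow> x = (y::'a::real_inner)"
  by (metis inner_diff_right inner_eq_zero_iff right_minus_eq)

lemma adj_eqI:
  assumes "bounded_linear T" "\<And>x. inner (T x) y = inner x z"
  shows "adj T y = z"
  by (rule inner_left_eqI) (simp add: assms inner_adj)

lemma bounded_linear_adj:
  fixes T :: "'a::complex_hilbert \<Rightarrow> 'b::complex_hilbert"
  assumes T: "bounded_linear T"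
  shows "bounded_linear (adj T)"
proof -
  interpret T: bounded_linear T by (rule T)
  obtain M where M: "0 \<le> M" "\<And>x. norm (T x) \<le> norm x * M"
    using T.nonneg_bounded by blast
  show ?thesis
  proof (rule bounded_linear_intro[where K=M])
    show "adj T (x + y) = adj T x + adj T y" for x y
      by (rule adj_eqI[OF T]) (simp add: inner_add_right inner_adj[OF T])
    show "adj T (r *\<^sub>R x) = r *\<^sub>R adj T x" for r x
      by (rule adj_eqI[OF T]) (simp add: inner_adj[OF T])
    fix y
    have "(norm (adj T y))\<^sup>2 = inner (T (adj T y)) y"
      by (simp add: power2_norm_eq_inner inner_adj[OF T])
    also have "\<dots> \<le> norm (T (adj T y)) * norm y"
      using Cauchy_Schwarz_ineq2 by (rule order_trans[OF abs_ge_self])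
    also have "\<dots> \<le> norm (adj T y) * M * norm y"
      by (intro mult_right_mono M) simp
    finally show "norm (adj T y) \<le> norm y * M"
      using M by (cases "norm (adj T y) = 0") (simp_all add: power2_eq_square mult_ac)
  qed
qed

subsection \<open>Extension by continuity\<close>

lemma subspace_closure:
  fixes S :: "'x::real_normed_vector set"
  assumes S: "subspace S"
  shows "subspace (closure S)"
proof (rule subspaceI)
  show "0 \<in> closure S" using subspace_0[OF S] closure_subset by blast
next
  fix x y assume "x \<in> closure S" "y \<in> closure S"
  then obtain f g where "\<And>n. f n \<in> S" "\<And>n. g n \<in> S" "f \<longlonglongrightarrow> x" "g \<longlonglongrightarrow> y"
    unfolding closure_sequential by blast
  then show "x + y \<in> closure S"
    unfolding closure_sequential
    by (intro exI[of _ "\<lambda>n. f n + g n"]) (simp add: tendsto_add subspace_add[OF S])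
next
  fix c x assume "x \<in> closure S"
  then obtain f where "\<And>n. f n \<in> S" "f \<longlonglongrightarrow> x"
    unfolding closure_sequential by blast
  then show "c *\<^sub>R x \<in> closure S"
    unfolding closure_sequential
    by (intro exI[of _ "\<lambda>n. c *\<^sub>R f n"]) (simp add: tendsto_scaleR subspace_scale[OF S])
qed

text \<open>\<open>\<Gamma>\<close> is a linear relation rather than a map, because a vector may
  have several expressions as a sum. The bound, applied to the difference of two pairs over the same
  x, forces equal values, so the closure of \<open>\<Gamma>\<close> is the graph of an
  operator.\<close>

lemma bop_extension:
  fixes \<Gamma> :: "('x::complex_hilbert \<times> 'y::complex_hilbert) set"
  assumes \<Gamma>: "subspace \<Gamma>" and C: "0 \<le> C"
    and bound: "\<And>x y. (x, y) \<in> \<Gamma> \<Longrightarrow> norm y \<le> C * norm x"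
    and im: "\<And>x y. (x, y) \<in> \<Gamma> \<Longrightarrow> (imult x, imult y) \<in> \<Gamma>"
    and dense: "closure (fst ` \<Gamma>) = UNIV"
  obtains T where "bop T" "\<And>x y. (x, y) \<in> \<Gamma> \<Longrightarrow> T x = y" "\<And>x. norm (T x) \<le> C * norm x"
proof -
  let ?\<Gamma> = "closure \<Gamma>"
  note sub = subspace_closure[OF \<Gamma>]
  have seq: "\<exists>f g. (\<forall>n. (f n, g n) \<in> \<Gamma>) \<and> f \<longlonglongrightarrow> x \<and> g \<longlonglongrightarrow> y" if "(x, y) \<in> ?\<Gamma>" for x y
  proof -
    from that obtain h where h: "\<And>n. h n \<in> \<Gamma>" "h \<longlonglongrightarrow> (x, y)"
      unfolding closure_sequential by blast
    from tendsto_fst[OF h(2)] tendsto_snd[OF h(2)] h(1) show ?thesis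
      by (intro exI[of _ "\<lambda>n. fst (h n)"] exI[of _ "\<lambda>n. snd (h n)"]) simp
  qed
  have bd: "norm y \<le> C * norm x" if "(x, y) \<in> ?\<Gamma>" for x y
  proof -
    from seq[OF that] obtain f g where fg: "\<And>n. (f n, g n) \<in> \<Gamma>" "f \<longlonglongrightarrow> x" "g \<longlonglongrightarrow> y"
      by blast
    show ?thesis
      by (rule LIMSEQ_le[OF tendsto_norm[OF fg(3)] tendsto_mult[OF tendsto_const tendsto_norm[OF fg(2)]]])
         (use fg(1) bound in blast)
  qed
  have im': "(imult x, imult y) \<in> ?\<Gamma>" if "(x, y) \<in> ?\<Gamma>" for x y
  proof -
    from seq[OF that] obtain f g where fg: "\<And>n. (f n, g n) \<in> \<Gamma>" "f \<longlonglongrightarrow> x" "g \<longlonglongrightarrow> y"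
      by blast
    have "(\<lambda>n. (imult (f n), imult (g n))) \<longlonglongrightarrow> (imult x, imult y)"
      by (intro tendsto_Pair bounded_linear.tendsto[OF bounded_linear_imult] fg)
    with fg(1) im show ?thesis
      unfolding closure_sequential by (intro exI[of _ "\<lambda>n. (imult (f n), imult (g n))"]) simp
  qed
  \<comment> \<open>The bound turns a convergent sequence of arguments into a Cauchy sequence of
    values; \<open>C + 1\<close> below avoids dividing by C = 0.\<close>
  have ex: "\<exists>y. (x, y) \<in> ?\<Gamma>" for x
  proof -
    have "x \<in> closure (fst ` \<Gamma>)" using dense by simp
    then obtain f where "\<forall>n. f n \<in> fst ` \<Gamma>" and f: "f \<longlonglongrightarrow> x"
      unfolding closure_sequential by blast
    then have "\<forall>n. \<exists>y. (f n, y) \<in> \<Gamma>" by force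
    then obtain g where g: "\<And>n. (f n, g n) \<in> \<Gamma>" by metis
    have le: "dist (g n) (g k) \<le> C * dist (f n) (f k)" for n k
      using bound[of "f n - f k" "g n - g k"] subspace_diff[OF \<Gamma> g[of n] g[of k]]
      by (simp add: dist_norm)
    have "Cauchy g"
    proof (rule metric_CauchyI)
      fix e :: real assume e: "0 < e"
      have "0 < e / (C + 1)" using e C by simp
      then obtain M where M: "\<And>n k. n \<ge> M \<Longrightarrow> k \<ge> M \<Longrightarrow> dist (f n) (f k) < e / (C + 1)"
        using metric_CauchyD[OF LIMSEQ_imp_Cauchy[OF f]] by blast
      have "dist (g n) (g k) < e" if "n \<ge> M" "k \<ge> M" for n k
      proof -
        have "dist (g n) (g k) \<le> (C + 1) * dist (f n) (f k)"
          using le[of n k] zero_le_dist[of "f n" "f k"] unfolding distrib_right by linarith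
        also have "\<dots> < (C + 1) * (e / (C + 1))"
          by (intro mult_strict_left_mono M that) (use C in simp)
        finally show ?thesis using C by simp
      qed
      then show "\<exists>M. \<forall>n\<ge>M. \<forall>k\<ge>M. dist (g n) (g k) < e" by blast
    qed
    then obtain y where "g \<longlonglongrightarrow> y" using Cauchy_convergent convergent_def by blast
    with f g have "(x, y) \<in> ?\<Gamma>"
      unfolding closure_sequential by (intro exI[of _ "\<lambda>n. (f n, g n)"]) (simp add: tendsto_Pair)
    then show ?thesis ..
  qed
  then obtain T where T: "\<And>x. (x, T x) \<in> ?\<Gamma>" by metis
  have T_eq: "T x = y" if "(x, y) \<in> ?\<Gamma>" for x y
    using bd[of "x - x" "T x - y"] subspace_diff[OF sub T[of x] that] by simp
  have "T (x + y) = T x + T y" for x y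
    using subspace_add[OF sub T[of x] T[of y]] by (intro T_eq) simp
  moreover have "T (r *\<^sub>R x) = r *\<^sub>R T x" for r x
    using subspace_scale[OF sub T[of x]] by (intro T_eq) simp
  moreover have "norm (T x) \<le> norm x * C" for x
    using bd[OF T] by (simp add: mult.commute)
  ultimately have "bounded_linear T" by (rule bounded_linear_intro)
  moreover have "T (imult x) = imult (T x)" for x
    using im'[OF T] by (rule T_eq)
  ultimately show ?thesis
    using T_eq bd[OF T] closure_subset[of \<Gamma>] by (intro that[of T]) (auto simp: bop_def)
qed

lemma bounded_linear_eq_on_closure:
  assumes "bounded_linear S" "bounded_linear T" "x \<in> closure D" "\<And>y. y \<in> D \<Longrightarrow> S y = T y"
  shows "S x = T x"
proof -
  have "closed {y. S y = T y}"
    using assms(1,2) by (intro closed_Collect_eq linear_continuous_on)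
  then show ?thesis using closure_minimal[of D "{y. S y = T y}"] assms(3,4) by blast
qed

subsection \<open>Kolmogorov decomposition of positive definite kernels\<close>

text \<open>Each summand ranges over the image of a linear map, so that the coefficients may be
  complex scalars (Kolmogorov decomposition) or vectors of H (dilation). Sums over different finite
  sets are compared by padding with 0.\<close>

lemma subspace_finite_sums:
  fixes L :: "'i \<Rightarrow> 'c::real_vector \<Rightarrow> 'v::real_vector"
  assumes L: "\<And>j. linear (L j)"
  shows "subspace {\<Sum>j\<in>F. L j (c j) |F c. finite F \<and> F \<subseteq> J}" (is "subspace ?S")
proof (rule subspaceI)
  show "0 \<in> ?S" by (auto intro!: exI[of _ "{}"])
next
  fix x y assume "x \<in> ?S" "y \<in> ?S"
  then obtain F c F' c' where F: "finite F" "F \<subseteq> J" "finite F'" "F' \<subseteq> J"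
    and xy: "x = (\<Sum>j\<in>F. L j (c j))" "y = (\<Sum>j\<in>F'. L j (c' j))"
    by blast
  define d d' where "d j = (if j \<in> F then c j else 0)"
    and "d' j = (if j \<in> F' then c' j else 0)" for j
  have "x = (\<Sum>j\<in>F \<union> F'. L j (d j))" "y = (\<Sum>j\<in>F \<union> F'. L j (d' j))"
    unfolding xy using F
    by (auto intro!: sum.mono_neutral_cong_left simp: d_def d'_def linear_0[OF L])
  then have "x + y = (\<Sum>j\<in>F \<union> F'. L j (d j + d' j))"
    by (simp add: linear_add[OF L] sum.distrib)
  with F show "x + y \<in> ?S"
    by (auto intro!: exI[of _ "F \<union> F'"] exI[of _ "\<lambda>j. d j + d' j"])
next
  fix r x assume "x \<in> ?S"
  then obtain F c where F: "finite F" "F \<subseteq> J" "x = (\<Sum>j\<in>F. L j (c j))"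
    by blast
  then have "r *\<^sub>R x = (\<Sum>j\<in>F. L j (r *\<^sub>R c j))"
    by (simp add: linear_scale[OF L] scaleR_right.sum)
  with F show "r *\<^sub>R x \<in> ?S"
    by (auto intro!: exI[of _ F] exI[of _ "\<lambda>j. r *\<^sub>R c j"])
qed

text \<open>Discriminant criterion. For d > 0 the vertex t = - b / d decides; for d = 0 the
  expression is affine in t, and the chosen t would give it the value -1.\<close>

lemma abs_le_of_quadratic_nonneg:
  fixes a b d :: real
  assumes nn: "\<And>t. 0 \<le> a\<^sup>2 + 2 * t * b + t\<^sup>2 * d" and "0 \<le> a" "0 \<le> d"
  shows "\<bar>b\<bar> \<le> sqrt d * a"
proof (cases "d = 0")
  case True
  have "b = 0"
  proof (rule ccontr)
    assume "b \<noteq> 0"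
    with nn[of "- (a\<^sup>2 + 1) / (2 * b)"] True show False by (simp add: field_simps)
  qed
  with True show ?thesis by simp
next
  case False
  with nn[of "- b / d"] assms(3) have "b\<^sup>2 \<le> d * a\<^sup>2"
    by (simp add: field_simps power2_eq_square)
  then have "sqrt (b\<^sup>2) \<le> sqrt (d * a\<^sup>2)" by (rule real_sqrt_le_mono)
  with assms show ?thesis by (simp add: real_sqrt_mult)
qed

lemma cinner_zero_on_closure:
  assumes "x \<in> closure D" "\<And>y. y \<in> D \<Longrightarrow> cinner y z = 0"
  shows "cinner x z = 0"
proof -
  have "inner y z = 0" "inner y (imult z) = 0" if "y \<in> D" for y
    using assms(2)[OF that] by (simp_all add: complex_eq_iff)
  then have "inner x z = 0" "inner x (imult z) = 0"
    using bounded_linear_eq_on_closure[OF bounded_linear_inner_left bounded_linear_zero assms(1)]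
    by blast+
  then show ?thesis by (simp add: complex_eq_iff)
qed

text \<open>The vectors are chosen by recursion along a well-order of the index set: the part of
  the i-th vector in the span of its predecessors is prescribed by the kernel, and the
  missing norm is supplied by the i-th orthonormal vector.\<close>
lemma kolmogorov_decomposition:
  fixes k :: "'i \<Rightarrow> 'i \<Rightarrow> complex" and e :: "'i \<Rightarrow> 'k::complex_hilbert"
  assumes herm: "\<And>i j. k j i = cnj (k i j)"
    and psd: "\<And>F c. finite F \<Longrightarrow> 0 \<le> Re (\<Sum>i\<in>F. \<Sum>j\<in>F. c j * cnj (c i) * k j i)"
    and e: "orthonormal_family e"
  obtains W :: "'i \<Rightarrow> 'k" where "\<And>i j. cinner (W i) (W j) = k i j"
proof -
  obtain r :: "'i rel" where r: "Well_order r" "Field r = UNIV"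
    using well_ordering[where 'a='i] by (elim exE conjE)
  define R where "R = r - Id"
  from r have tot: "total_on UNIV r" and tr: "Relation.trans r" and anti: "antisym r" and wf: "wf R"
    by (simp_all add: order_on_defs R_def)
  have total: "(i, j) \<in> R \<or> i = j \<or> (j, i) \<in> R" for i j
    using tot by (auto simp: total_on_def R_def)
  have irr: "(i, i) \<notin> R" for i
    by (simp add: R_def)
  have trans: "(i, l) \<in> R" if "(i, j) \<in> R" "(j, l) \<in> R" for i j l
    using that transD[OF tr, of i j l] antisymD[OF anti, of i j] by (auto simp: R_def)
  have ee: "cinner (e i) (e j) = (if i = j then 1 else 0)" for i j
    using e by (simp add: orthonormal_family_def)
  \<comment> \<open>The last clause keeps every later \<open>e l\<close> orthogonal to what has been
    chosen, so \<open>e i\<close> is still free when step i needs it.\<close>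
  define P where "P f i w \<longleftrightarrow> (\<forall>j. (j, i) \<in> R \<longrightarrow> cinner (f j) w = k j i) \<and>
      cinner w w = k i i \<and> (\<forall>l. (i, l) \<in> R \<longrightarrow> cinner w (e l) = 0)"
    for f :: "'i \<Rightarrow> 'k" and i w
  have step: "\<exists>w. P f i w" if prev: "\<And>j. (j, i) \<in> R \<Longrightarrow> P f j (f j)" for f i
  proof -
    define J where "J = {j. (j, i) \<in> R}"
    have gram: "cinner (f j) (f l) = k j l" if "j \<in> J" "l \<in> J" for j l
    proof -
      have Pj: "P f j (f j)" and Pl: "P f l (f l)" using prev that by (simp_all add: J_def)
      consider "(j, l) \<in> R" | "j = l" | "(l, j) \<in> R" using total by blast
      then show ?thesis
        using Pj Pl unfolding P_def by cases (blast, blast, metis cinner_commute herm)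
    qed
    \<comment> \<open>Graph of the real functional sending a combination of predecessors to the real
      part of its prescribed inner product with the i-th vector.\<close>
    define L where "L j c = (scaleC c (f j), Re (c * k j i))" for j c
    have L: "linear (L j)" for j
      by (rule linearI) (simp_all add: L_def scaleC_def algebra_simps scaleR_add_left)
    define \<Gamma> where "\<Gamma> = {\<Sum>j\<in>F. L j (c j) |F c. finite F \<and> F \<subseteq> J}"
    have \<Gamma>: "subspace \<Gamma>"
      unfolding \<Gamma>_def by (rule subspace_finite_sums[OF L])
    have kii: "k i i = complex_of_real (Re (k i i))"
      using arg_cong[OF herm[of i i], of Im] by (simp add: complex_eq_iff)
    have kpos: "0 \<le> Re (k i i)"
      using psd[of "{i}" "\<lambda>_. 1"] by simp
    have bound: "\<bar>q\<bar> \<le> sqrt (Re (k i i)) * norm x" if xq: "(x, q) \<in> \<Gamma>" for x q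
    proof (rule abs_le_of_quadratic_nonneg[OF _ norm_ge_zero kpos])
      fix t :: real
      obtain F c where F: "finite F" "F \<subseteq> J" "(x, q) = (\<Sum>j\<in>F. L j (c j))"
        using xq unfolding \<Gamma>_def by blast
      have x: "x = (\<Sum>j\<in>F. scaleC (c j) (f j))" and q: "q = Re (\<Sum>j\<in>F. c j * k j i)"
        using arg_cong[OF F(3), of fst] arg_cong[OF F(3), of snd]
        by (simp_all add: fst_sum snd_sum L_def)
      have iF: "i \<notin> F" using F(2) irr by (auto simp: J_def)
      \<comment> \<open>Giving i the real coefficient t turns positivity on
        \<open>insert i F\<close> into a nonnegative quadratic in t, whose discriminant bound is the
        one Riesz needs.\<close>
      define c' where "c' = c(i := complex_of_real t)"
      have "cinner x x = (\<Sum>a\<in>F. \<Sum>b\<in>F. c b * cnj (c a) * k b a)"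
        unfolding x cinner_sum_left cinner_sum_right cinner_scaleC_left cinner_scaleC_right
        using F(2) gram
        by (auto simp: sum_distrib_left mult_ac subset_iff intro!: sum.cong)
      then have nx: "Re (\<Sum>a\<in>F. \<Sum>b\<in>F. c b * cnj (c a) * k b a) = (norm x)\<^sup>2"
        by (metis Re_cinner power2_norm_eq_inner)
      have cF: "c' a = c a" if "a \<in> F" for a using that iF by (auto simp: c'_def)
      define z where "z = (\<Sum>b\<in>F. c b * k b i)"
      have ki: "k i a = cnj (k a i)" for a by (rule herm)
      have "(\<Sum>b\<in>insert i F. c' b * cnj (c' i) * k b i) = t * t * k i i + t * z"
      proof -
        have "(\<Sum>b\<in>F. c' b * cnj (c' i) * k b i) = t * z"
          unfolding z_def sum_distrib_left
          by (intro sum.cong refl) (simp add: cF, simp add: c'_def)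
        then show ?thesis using F(1) iF by (simp add: c'_def)
      qed
      moreover have "(\<Sum>a\<in>F. \<Sum>b\<in>insert i F. c' b * cnj (c' a) * k b a) =
          t * cnj z + (\<Sum>a\<in>F. \<Sum>b\<in>F. c b * cnj (c a) * k b a)"
      proof -
        have "(\<Sum>a\<in>F. \<Sum>b\<in>insert i F. c' b * cnj (c' a) * k b a) =
            (\<Sum>a\<in>F. t * cnj (c a * k a i) + (\<Sum>b\<in>F. c b * cnj (c a) * k b a))"
        proof (intro sum.cong refl)
          fix a assume a: "a \<in> F"
          have "c' i = t" by (simp add: c'_def)
          moreover have "(\<Sum>b\<in>F. c' b * cnj (c' a) * k b a) = (\<Sum>b\<in>F. c b * cnj (c a) * k b a)"
            using a by (intro sum.cong refl) (simp add: cF)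
          ultimately show "(\<Sum>b\<in>insert i F. c' b * cnj (c' a) * k b a) =
              t * cnj (c a * k a i) + (\<Sum>b\<in>F. c b * cnj (c a) * k b a)"
            using F(1) iF by (simp add: cF[OF a] ki[of a])
        qed
        then show ?thesis
          by (simp only: sum.distrib sum_distrib_left[symmetric] cnj_sum z_def)
      qed
      ultimately have "(\<Sum>a\<in>insert i F. \<Sum>b\<in>insert i F. c' b * cnj (c' a) * k b a) =
          t * t * k i i + t * z + (t * cnj z + (\<Sum>a\<in>F. \<Sum>b\<in>F. c b * cnj (c a) * k b a))"
        using F(1) iF by simp
      then have "Re (\<Sum>a\<in>insert i F. \<Sum>b\<in>insert i F. c' b * cnj (c' a) * k b a) =
          t * t * Re (k i i) + 2 * (t * Re z) + (norm x)\<^sup>2"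
        using nx by simp
      then show "0 \<le> (norm x)\<^sup>2 + 2 * t * q + t\<^sup>2 * Re (k i i)"
        using psd[of "insert i F" c'] F(1) by (simp add: power2_eq_square q z_def del: Re_sum)
    qed
    obtain v where v: "v \<in> closure (fst ` \<Gamma>)" "norm v \<le> sqrt (Re (k i i))"
      "\<And>x q. (x, q) \<in> \<Gamma> \<Longrightarrow> inner x v = q"
      using riesz_graph[OF \<Gamma> _ bound] kpos by (metis real_sqrt_ge_zero)
    have fv: "cinner (f j) v = k j i" if "j \<in> J" for j
    proof -
      have "L j c \<in> \<Gamma>" for c
        unfolding \<Gamma>_def using that by (auto intro!: exI[of _ "{j}"] exI[of _ "\<lambda>_. c"])
      then have "inner (scaleC c (f j)) v = Re (c * k j i)" for c
        using v(3) by (simp add: L_def)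
      then have "Re (c * cinner (f j) v) = Re (c * k j i)" for c
        by (metis Re_cinner cinner_scaleC_left)
      \<comment> \<open>c = 1 gives the real part, c = \<open>\<i>\<close> the imaginary
        part.\<close>
      from this[of 1] this[of \<i>] show ?thesis by (simp add: complex_eq_iff)
    qed
    have fe: "cinner (f j) (e l) = 0" if "j \<in> J" "l = i \<or> (i, l) \<in> R" for j l
      using that prev[of j] trans[of j i l] by (auto simp: J_def P_def)
    have ve: "cinner v (e l) = 0" if "l = i \<or> (i, l) \<in> R" for l
      using v(1)
    proof (rule cinner_zero_on_closure)
      fix y assume "y \<in> fst ` \<Gamma>"
      then obtain F c where "F \<subseteq> J" "y = (\<Sum>j\<in>F. scaleC (c j) (f j))"
        by (auto simp: \<Gamma>_def L_def fst_sum)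
      with fe[OF _ that] show "cinner y (e l) = 0"
        by (simp add: cinner_sum_left cinner_scaleC_left subset_iff)
    qed
    have "(norm v)\<^sup>2 \<le> Re (k i i)"
      using v(2) kpos by (metis norm_ge_zero power_mono real_sqrt_pow2)
    \<comment> \<open>The Riesz bound on \<open>norm v\<close> makes the radicand
      nonnegative.\<close>
    define d where "d = sqrt (Re (k i i) - (norm v)\<^sup>2)"
    have d: "d\<^sup>2 = Re (k i i) - (norm v)\<^sup>2"
      using \<open>(norm v)\<^sup>2 \<le> Re (k i i)\<close> by (simp add: d_def)
    let ?w = "v + scaleC (complex_of_real d) (e i)"
    have "cinner (e i) v = 0"
      using ve[of i] by (subst cinner_commute) simp
    then have "cinner ?w ?w = complex_of_real ((norm v)\<^sup>2 + d\<^sup>2)"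
      using ve[of i] ee[of i i]
      by (simp add: cinner_add_left cinner_add_right cinner_scaleC_left cinner_scaleC_right
          cinner_self[of v] power2_eq_square)
    then have "cinner ?w ?w = k i i"
      using d kii by simp
    moreover have "cinner (f j) ?w = k j i" if "(j, i) \<in> R" for j
      using fv[of j] fe[of j i] that by (simp add: cinner_add_right cinner_scaleC_right J_def)
    moreover have "cinner ?w (e l) = 0" if "(i, l) \<in> R" for l
      using ve[of l] that irr[of i] ee[of i l]
      by (auto simp add: cinner_add_left cinner_scaleC_left)
    ultimately show ?thesis unfolding P_def by blast
  qed
  have "\<exists>f. \<forall>i. P f i (f i)"
  \<comment> \<open>\<open>P f i\<close> reads f only at predecessors of i, as well-founded choice
    demands.\<close>
  proof (rule dependent_wf_choice[where P = P, OF wf])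
    show "P f x w = P g x w" if "\<And>z. (z, x) \<in> R \<Longrightarrow> f z = g z" for f g x w
      unfolding P_def using that by simp
  qed (rule step)
  then obtain W where W: "\<And>i. P W i (W i)" by blast
  have "cinner (W i) (W j) = k i j" for i j
  proof -
    consider "(i, j) \<in> R" | "i = j" | "(j, i) \<in> R" using total by blast
    then show ?thesis
      using W[of i] W[of j] unfolding P_def by cases (blast, blast, metis cinner_commute herm)
  qed
  then show ?thesis by (rule that)
qed

text \<open>Positivity at the two points s, t includes reality of the sum. Its diagonal terms are
  real because \<open>\<phi> 0 = id\<close>, so the off-diagonal imaginary parts cancel; replacing x
  by \<open>\<i>\<close> x treats the real parts.\<close>

lemma cpd_hermitian:
  fixes \<phi> :: "'g::group_add \<Rightarrow> 'h::complex_hilbert \<Rightarrow> 'h"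
  assumes cpd: "cpd \<phi>" and bop: "\<And>s. bop (\<phi> s)" and unital: "\<phi> 0 = id"
  shows "cinner (\<phi> (- t + s) y) x = cnj (cinner (\<phi> (- s + t) x) y)"
proof -
  have *: "Im (cinner (\<phi> (- s + t) x) y) + Im (cinner (\<phi> (- t + s) y) x) = 0" for x y
  proof -
    show ?thesis
      using cpd[unfolded cpd_def, rule_format, of "\<lambda>i. if i = 0 then s else t" "\<lambda>i. if i = 0 then y else x" 2]
      by (simp add: numeral_2_eq_2 cpos_def unital)
  qed
  have sc: "\<phi> u (scaleC c z) = scaleC c (\<phi> u z)" for u c z
    using bop by (rule bop_scaleC)
  show ?thesis
    using *[of x y] *[of "scaleC \<i> x" y]
    unfolding complex_eq_iff sc cinner_scaleC_left cinner_scaleC_right by auto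
qed

text \<open>\<open>cpd\<close> has no scalars and sums over initial segments of the naturals: F is
  enumerated and each scalar is absorbed into its vector. Group elements may repeat in
  \<open>cpd\<close>, as they do among the pairs in F.\<close>

lemma cpd_positive_kernel:
  fixes \<phi> :: "'g::group_add \<Rightarrow> 'h::complex_hilbert \<Rightarrow> 'h" and c :: "'g \<times> 'h \<Rightarrow> complex"
  assumes cpd: "cpd \<phi>" and bop: "\<And>s. bop (\<phi> s)" and F: "finite F"
  shows "0 \<le> Re (\<Sum>i\<in>F. \<Sum>j\<in>F. c j * cnj (c i) * cinner (\<phi> (- fst i + fst j) (snd j)) (snd i))"
proof -
  obtain f where f: "bij_betw f {..<card F} F"
    using ex_bij_betw_nat_finite[OF F] by (auto simp: lessThan_atLeast0)
  let ?s = "\<lambda>n. fst (f n)" and ?h = "\<lambda>n. scaleC (c (f n)) (snd (f n))"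
  have "cpos (\<Sum>i<card F. \<Sum>j<card F. cinner (\<phi> (- ?s i + ?s j) (?h j)) (?h i))"
    using cpd unfolding cpd_def by (elim allE)
  also have "(\<Sum>i<card F. \<Sum>j<card F. cinner (\<phi> (- ?s i + ?s j) (?h j)) (?h i)) =
      (\<Sum>i<card F. \<Sum>j\<in>F. c j * cnj (c (f i)) * cinner (\<phi> (- ?s i + fst j) (snd j)) (snd (f i)))"
    by (subst sum.reindex_bij_betw[OF f, symmetric])
      (simp add: bop_scaleC[OF bop] cinner_scaleC_left cinner_scaleC_right mult_ac)
  also have "\<dots> = (\<Sum>i\<in>F. \<Sum>j\<in>F. c j * cnj (c i) * cinner (\<phi> (- fst i + fst j) (snd j)) (snd i))"
    by (rule sum.reindex_bij_betw[OF f])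
  finally show ?thesis by (simp add: cpos_def)
qed

text \<open>The kernel lives on pairs (s, h), so the decomposition spends one orthonormal vector per
  pair; this explains the index type of e.\<close>

lemma naimark_family:
  fixes \<phi> :: "'g::group_add \<Rightarrow> 'h::complex_hilbert \<Rightarrow> 'h" and e :: "'g \<times> 'h \<Rightarrow> 'k::complex_hilbert"
  assumes "cpd \<phi>" "\<And>s. bop (\<phi> s)" "\<phi> 0 = id" "orthonormal_family e"
  obtains W :: "'g \<Rightarrow> 'h \<Rightarrow> 'k"
  where "\<And>s t x y. cinner (W t x) (W s y) = cinner (\<phi> (- s + t) x) y"
proof -
  define k where "k j i = cinner (\<phi> (- fst i + fst j) (snd j)) (snd i)" for i j :: "'g \<times> 'h"
  have "k j i = cnj (k i j)" for i j
    unfolding k_def by (rule cpd_hermitian) fact+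
  moreover have "0 \<le> Re (\<Sum>i\<in>F. \<Sum>j\<in>F. c j * cnj (c i) * k j i)" if "finite F" for F c
    unfolding k_def by (rule cpd_positive_kernel) fact+
  ultimately show ?thesis
  proof (rule kolmogorov_decomposition[OF _ _ assms(4), of k])
    fix W :: "'g \<times> 'h \<Rightarrow> 'k"
    assume W: "\<And>i j. cinner (W i) (W j) = k i j"
    show ?thesis
      by (rule that[of "\<lambda>s h. W (s, h)"]) (simp add: W k_def)
  qed
qed

subsection \<open>Matrix norms\<close>

text \<open>A real supremum obeys the usual rules only on bounded sets; the sum of all entry norms
  is a crude but sufficient bound.\<close>

lemma mnorm_set_bdd_above:
  fixes T :: "nat \<Rightarrow> nat \<Rightarrow> 'a::real_normed_vector \<Rightarrow> 'b::real_normed_vector"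
  assumes T: "\<And>i j. i < n \<Longrightarrow> j < n \<Longrightarrow> bounded_linear (T i j)"
  shows "bdd_above ((\<lambda>h. sqrt (\<Sum>i<n. (norm (\<Sum>j<n. T i j (h j)))\<^sup>2)) `
    {h. (\<Sum>j<n. (norm (h j))\<^sup>2) \<le> 1})"
proof (rule bdd_aboveI2)
  fix h :: "nat \<Rightarrow> 'a" assume "h \<in> {h. (\<Sum>j<n. (norm (h j))\<^sup>2) \<le> 1}"
  then have h: "(\<Sum>j<n. (norm (h j))\<^sup>2) \<le> 1" by simp
  have h1: "norm (h j) \<le> 1" if "j < n" for j
  proof -
    have "(norm (h j))\<^sup>2 \<le> (\<Sum>j<n. (norm (h j))\<^sup>2)"
      by (rule member_le_sum) (use that in auto)
    with h have "(norm (h j))\<^sup>2 \<le> 1\<^sup>2" by simp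
    then show ?thesis by (rule power2_le_imp_le) simp
  qed
  have "sqrt (\<Sum>i<n. (norm (\<Sum>j<n. T i j (h j)))\<^sup>2) \<le> (\<Sum>i<n. norm (\<Sum>j<n. T i j (h j)))"
    using L2_set_le_sum[of "{..<n}" "\<lambda>i. norm (\<Sum>j<n. T i j (h j))"] by (simp add: L2_set_def)
  also have "\<dots> \<le> (\<Sum>i<n. \<Sum>j<n. onorm (T i j))"
  proof (intro sum_mono sum_norm_le)
    fix i j assume ij: "i \<in> {..<n}" "j \<in> {..<n}"
    then have "norm (T i j (h j)) \<le> onorm (T i j) * norm (h j)"
      by (intro onorm T) auto
    also have "\<dots> \<le> onorm (T i j) * 1"
      using ij by (intro mult_left_mono h1 onorm_pos_le T) auto
    finally show "norm (T i j (h j)) \<le> onorm (T i j)" by simp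
  qed
  finally show "sqrt (\<Sum>i<n. (norm (\<Sum>j<n. T i j (h j)))\<^sup>2) \<le> (\<Sum>i<n. \<Sum>j<n. onorm (T i j))" .
qed

lemma mnorm_nonneg:
  fixes T :: "nat \<Rightarrow> nat \<Rightarrow> 'a::real_normed_vector \<Rightarrow> 'b::real_normed_vector"
  assumes T: "\<And>i j. i < n \<Longrightarrow> j < n \<Longrightarrow> bounded_linear (T i j)"
  shows "0 \<le> mnorm n T"
proof -
  have "sqrt (\<Sum>i<n. (norm (\<Sum>j<n. T i j ((\<lambda>_. 0) j)))\<^sup>2) \<le> mnorm n T"
    unfolding mnorm_def by (rule cSUP_upper[OF _ mnorm_set_bdd_above[OF T]]) auto
  then show ?thesis by (rule order_trans[rotated]) (simp add: sum_nonneg)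
qed

lemma mnorm_bound:
  fixes T :: "nat \<Rightarrow> nat \<Rightarrow> 'a::real_normed_vector \<Rightarrow> 'b::real_normed_vector"
  assumes T: "\<And>i j. i < n \<Longrightarrow> j < n \<Longrightarrow> bounded_linear (T i j)"
  shows "(\<Sum>i<n. (norm (\<Sum>j<n. T i j (h j)))\<^sup>2) \<le> (mnorm n T)\<^sup>2 * (\<Sum>j<n. (norm (h j))\<^sup>2)"
proof (cases "(\<Sum>j<n. (norm (h j))\<^sup>2) = 0")
  case True
  then have "h j = 0" if "j < n" for j
    using that by (simp add: sum_nonneg_eq_0_iff)
  then have "(\<Sum>j<n. T i j (h j)) = 0" if "i < n" for i
    using that T by (intro sum.neutral) (simp add: linear_0 bounded_linear.linear)
  then show ?thesis using True by simp
next
  case False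
  define N where "N = sqrt (\<Sum>j<n. (norm (h j))\<^sup>2)"
  have N: "0 < N" "N\<^sup>2 = (\<Sum>j<n. (norm (h j))\<^sup>2)"
    using False by (simp_all add: N_def sum_nonneg less_le)
  have sc: "(\<Sum>j<n. T i j (inverse N *\<^sub>R h j)) = inverse N *\<^sub>R (\<Sum>j<n. T i j (h j))" if "i < n" for i
    using that T by (simp add: scaleR_right.sum linear_scale bounded_linear.linear)
  have "(\<Sum>j<n. (norm (inverse N *\<^sub>R h j))\<^sup>2) = (inverse N)\<^sup>2 * N\<^sup>2"
    using N(1) by (simp add: N(2) power_mult_distrib sum_distrib_left)
  also have "\<dots> = 1" using N(1) by (simp add: field_simps)
  finally have "sqrt (\<Sum>i<n. (norm (\<Sum>j<n. T i j (inverse N *\<^sub>R h j)))\<^sup>2) \<le> mnorm n T"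
    unfolding mnorm_def by (intro cSUP_upper[OF _ mnorm_set_bdd_above[OF T]]) auto
  moreover have "(\<Sum>i<n. (norm (\<Sum>j<n. T i j (inverse N *\<^sub>R h j)))\<^sup>2) =
      (inverse N)\<^sup>2 * (\<Sum>i<n. (norm (\<Sum>j<n. T i j (h j)))\<^sup>2)"
    using N(1) by (simp add: sc power_mult_distrib sum_distrib_left)
  ultimately have "sqrt ((inverse N)\<^sup>2 * (\<Sum>i<n. (norm (\<Sum>j<n. T i j (h j)))\<^sup>2)) \<le> mnorm n T"
    by simp
  then have "(inverse N)\<^sup>2 * (\<Sum>i<n. (norm (\<Sum>j<n. T i j (h j)))\<^sup>2) \<le> (mnorm n T)\<^sup>2"
    using mnorm_nonneg[OF T] by (simp add: real_sqrt_le_iff' sqrt_le_D)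
  then show ?thesis
    using N(1) unfolding N(2)[symmetric] by (simp add: field_simps)
qed

lemma mnorm_leI:
  fixes T :: "nat \<Rightarrow> nat \<Rightarrow> 'a::real_normed_vector \<Rightarrow> 'b::real_normed_vector"
  assumes "0 \<le> M"
    and "\<And>h. (\<Sum>i<n. (norm (\<Sum>j<n. T i j (h j)))\<^sup>2) \<le> M\<^sup>2 * (\<Sum>j<n. (norm (h j))\<^sup>2)"
  shows "mnorm n T \<le> M"
  unfolding mnorm_def
proof (rule cSUP_least)
  show "{h. (\<Sum>j<n. (norm (h j))\<^sup>2) \<le> 1} \<noteq> {}"
    by (auto intro!: exI[of _ "\<lambda>_. 0"])
next
  fix h :: "nat \<Rightarrow> 'a" assume "h \<in> {h. (\<Sum>j<n. (norm (h j))\<^sup>2) \<le> 1}"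
  then have "M\<^sup>2 * (\<Sum>j<n. (norm (h j))\<^sup>2) \<le> M\<^sup>2 * 1"
    by (intro mult_left_mono) auto
  with assms(2)[of h] show "sqrt (\<Sum>i<n. (norm (\<Sum>j<n. T i j (h j)))\<^sup>2) \<le> M"
    using assms(1) by (intro real_le_lsqrt) (auto simp: sum_nonneg)
qed

subsection \<open>A contraction estimate for commuting operators\<close>

text \<open>The sequence of squared seminorms of the powers of B is logarithmically convex, so
  a first step larger than L would force growth faster than L to the m.\<close>
lemma symmetric_operator_bound:
  fixes q :: "'v \<Rightarrow> 'v \<Rightarrow> real"
  assumes CS: "\<And>x y. (q x y)\<^sup>2 \<le> q x x * q y y" and pos: "\<And>x. 0 \<le> q x x"
    and sym: "\<And>x y. q (B x) y = q x (B y)"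
    and L: "0 \<le> L" and bound: "\<And>m. q ((B ^^ m) x) ((B ^^ m) x) \<le> C * L ^ m"
  shows "q (B x) (B x) \<le> L * q x x"
proof (rule ccontr)
  define a where "a m = q ((B ^^ m) x) ((B ^^ m) x)" for m
  assume "\<not> q (B x) (B x) \<le> L * q x x"
  then have a1: "L * a 0 < a 1" by (simp add: a_def)
  have nn: "0 \<le> a m" for m by (simp add: a_def pos)
  \<comment> \<open>Symmetry moves one B across: \<open>a (Suc m)\<close> is q of the m-th and the
    (m+2)-nd iterate, to which Cauchy-Schwarz applies.\<close>
  have convex: "(a (Suc m))\<^sup>2 \<le> a m * a (Suc (Suc m))" for m
    using CS[of "(B ^^ m) x" "(B ^^ Suc (Suc m)) x"] by (simp add: a_def sym)
  have a0: "0 < a 0"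
  proof (rule ccontr)
    assume "\<not> 0 < a 0"
    with nn[of 0] have "a 0 = 0" by simp
    with convex[of 0] a1 show False by simp
  qed
  define r where "r = a 1 / a 0"
  have r: "L < r" using a1 a0 by (simp add: r_def field_simps)
  \<comment> \<open>Convexity makes the ratios of consecutive terms nondecreasing, so none falls
    below the first one, r. Positivity is carried along to allow cancellation.\<close>
  have ratio: "r * a m \<le> a (Suc m) \<and> 0 < a m" for m
  proof (induction m)
    case 0
    then show ?case using a0 by (simp add: r_def)
  next
    case (Suc m)
    have pos': "0 < a (Suc m)"
      using Suc r L by (meson less_le_trans mult_pos_pos le_less_trans)
    have "a m * (r * a (Suc m)) \<le> (a (Suc m))\<^sup>2"
      using mult_right_mono[of "r * a m" "a (Suc m)" "a (Suc m)"] Suc pos'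
      by (simp add: power2_eq_square mult_ac)
    also note convex[of m]
    finally show ?case using Suc pos' by simp
  qed
  have "r ^ m * a 0 \<le> a m" for m
  proof (induction m)
    case (Suc m)
    have "r ^ Suc m * a 0 \<le> r * a m"
      using mult_left_mono[OF Suc, of r] r L by (simp add: mult_ac)
    also have "\<dots> \<le> a (Suc m)" using ratio by blast
    finally show ?case .
  qed simp
  then have le: "r ^ m * a 0 \<le> C * L ^ m" for m
    using bound[of m] unfolding a_def by (rule order_trans)
  show False
  proof (cases "L = 0")
    case True
    with le[of 1] a0 r show False by (simp add: mult_le_0_iff)
  next
    case False
    with L r obtain m where m: "C / a 0 < (r / L) ^ m"
      using real_arch_pow[of "r / L" "C / a 0"] by auto
    have "0 < L ^ m" using L False by simp
    with m a0 have "C * L ^ m < r ^ m * a 0" by (simp add: power_divide field_simps)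
    with le[of m] show False by simp
  qed
qed

lemma sum_inner_Cauchy_Schwarz:
  fixes f g :: "'i \<Rightarrow> 'a::real_inner"
  shows "(\<Sum>i\<in>I. inner (f i) (g i))\<^sup>2 \<le> (\<Sum>i\<in>I. (norm (f i))\<^sup>2) * (\<Sum>i\<in>I. (norm (g i))\<^sup>2)"
proof -
  have "\<bar>\<Sum>i\<in>I. inner (f i) (g i)\<bar> \<le> (\<Sum>i\<in>I. \<bar>norm (f i)\<bar> * \<bar>norm (g i)\<bar>)"
    by (rule order_trans[OF sum_abs sum_mono]) (simp add: Cauchy_Schwarz_ineq2)
  also have "\<dots> \<le> L2_set (\<lambda>i. norm (f i)) I * L2_set (\<lambda>i. norm (g i)) I"
    by (rule L2_set_mult_ineq)
  finally have "(\<Sum>i\<in>I. inner (f i) (g i))\<^sup>2 \<le>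
      (L2_set (\<lambda>i. norm (f i)) I * L2_set (\<lambda>i. norm (g i)) I)\<^sup>2"
    by (rule power2_le_iff_abs_le[THEN iffD2, rotated]) (simp add: L2_set_nonneg)
  then show ?thesis
    by (simp add: power_mult_distrib L2_set_def sum_nonneg)
qed

text \<open>Write \<open>\<Phi>\<close> for the Gram operator of the family W and D for the block diagonal matrix of the
  operators \<open>T s i j\<close>. The hypothesis \<open>intertwine\<close> says that \<open>\<Phi>\<close> commutes with D. Then the
  operator \<open>D\<^sup>* D\<close> is symmetric for the form defined by \<open>\<Phi>\<close>, and its bound in the original norm
  carries over to the seminorm of this form.\<close>
lemma gram_contraction:
  fixes W :: "'g \<Rightarrow> 'h::complex_hilbert \<Rightarrow> 'k::complex_hilbert"
    and T :: "'g \<Rightarrow> nat \<Rightarrow> nat \<Rightarrow> 'h \<Rightarrow> 'h"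
  assumes W: "\<And>s. bounded_linear (W s)" and norm_W: "\<And>s h. norm (W s h) = norm h"
    and T: "\<And>s i j. i < n \<Longrightarrow> j < n \<Longrightarrow> bounded_linear (T s i j)"
    and intertwine: "\<And>s t i j x y. i < n \<Longrightarrow> j < n \<Longrightarrow>
      inner (W t (T t i j x)) (W s y) = inner (W t x) (W s (adj (T s i j) y))"
    and T_bound: "\<And>s x. (\<Sum>i<n. (norm (\<Sum>j<n. T s i j (x j)))\<^sup>2) \<le> M\<^sup>2 * (\<Sum>j<n. (norm (x j))\<^sup>2)"
    and F: "finite F"
  shows "(\<Sum>i<n. (norm (\<Sum>s\<in>F. W s (\<Sum>j<n. T s i j (z j s))))\<^sup>2) \<le>
    M\<^sup>2 * (\<Sum>j<n. (norm (\<Sum>s\<in>F. W s (z j s)))\<^sup>2)"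
proof -
  \<comment> \<open>q is the Gram form and p the plain l2 form on coefficient tuples; D and E will
    be adjoint to each other for both.\<close>
  define U where "U v = (\<Sum>s\<in>F. W s (v s))" for v
  define q where "q x y = (\<Sum>i<n. inner (U (x i)) (U (y i)))" for x y :: "nat \<Rightarrow> 'g \<Rightarrow> 'h"
  define p where "p x y = (\<Sum>i<n. \<Sum>s\<in>F. inner (x i s) (y i s))" for x y :: "nat \<Rightarrow> 'g \<Rightarrow> 'h"
  define D where "D x = (\<lambda>i s. \<Sum>j<n. T s i j (x j s))" for x :: "nat \<Rightarrow> 'g \<Rightarrow> 'h"
  define E where "E y = (\<lambda>j s. \<Sum>i<n. adj (T s i j) (y i s))" for y :: "nat \<Rightarrow> 'g \<Rightarrow> 'h"
  have q_self: "q x x = (\<Sum>i<n. (norm (U (x i)))\<^sup>2)" for x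
    by (simp add: q_def power2_norm_eq_inner)
  have p_self: "p x x = (\<Sum>i<n. \<Sum>s\<in>F. (norm (x i s))\<^sup>2)" for x
    by (simp add: p_def power2_norm_eq_inner)
  have q_pos: "0 \<le> q x x" and p_pos: "0 \<le> p x x" for x
    by (simp_all add: q_self p_self sum_nonneg)
  have q_comm: "q x y = q y x" for x y
    by (simp add: q_def inner_commute)
  have q_CS: "(q x y)\<^sup>2 \<le> q x x * q y y" for x y
    unfolding q_self by (simp add: q_def sum_inner_Cauchy_Schwarz)
  have p_CS: "(p x y)\<^sup>2 \<le> p x x * p y y" for x y
    using sum_inner_Cauchy_Schwarz[of "\<lambda>(i, s). x i s" "\<lambda>(i, s). y i s" "{..<n} \<times> F"]
    unfolding p_self unfolding p_def sum.cartesian_product by (simp add: case_prod_beta)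
  have W_sum: "W s (sum f I) = (\<Sum>i\<in>I. W s (f i))" for s f and I :: "nat set"
    by (rule linear_sum[OF bounded_linear.linear[OF W]])
  have inner_U: "inner (U v) (U w) = (\<Sum>t\<in>F. \<Sum>s\<in>F. inner (W t (v t)) (W s (w s)))" for v w
    unfolding U_def inner_sum_left by (simp add: inner_sum_right)
  have q_adj: "q (D x) y = q x (E y)" for x y
  proof -
    have "q (D x) y = (\<Sum>i<n. \<Sum>t\<in>F. \<Sum>s\<in>F. \<Sum>j<n. inner (W t (T t i j (x j t))) (W s (y i s)))"
      unfolding q_def inner_U D_def W_sum by (simp add: inner_sum_left)
    also have "\<dots> = (\<Sum>i<n. \<Sum>t\<in>F. \<Sum>s\<in>F. \<Sum>j<n. inner (W t (x j t)) (W s (adj (T s i j) (y i s))))"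
      by (intro sum.cong refl intertwine) auto
    also have "\<dots> = (\<Sum>j<n. \<Sum>i<n. \<Sum>t\<in>F. \<Sum>s\<in>F. inner (W t (x j t)) (W s (adj (T s i j) (y i s))))"
      by (simp only: sum.swap[of _ "{..<n}" F]) (rule sum.swap)
    also have "\<dots> = q x (E y)"
      unfolding q_def inner_U E_def W_sum inner_sum_right
      by (simp only: sum.swap[of _ "{..<n}" F])
    finally show ?thesis .
  qed
  have p_adj: "p (D x) y = p x (E y)" for x y
  proof -
    have "p (D x) y = (\<Sum>i<n. \<Sum>s\<in>F. \<Sum>j<n. inner (x j s) (adj (T s i j) (y i s)))"
      unfolding p_def D_def inner_sum_left
      by (intro sum.cong refl inner_adj[symmetric] T) auto
    also have "\<dots> = (\<Sum>j<n. \<Sum>i<n. \<Sum>s\<in>F. inner (x j s) (adj (T s i j) (y i s)))"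
      by (simp only: sum.swap[of _ "{..<n}" F]) (rule sum.swap)
    also have "\<dots> = p x (E y)"
      unfolding p_def E_def inner_sum_right by (simp only: sum.swap[of _ "{..<n}" F])
    finally show ?thesis .
  qed
  have p_D: "p (D x) (D x) \<le> M\<^sup>2 * p x x" for x
  proof -
    have "p (D x) (D x) = (\<Sum>s\<in>F. \<Sum>i<n. (norm (\<Sum>j<n. T s i j (x j s)))\<^sup>2)"
      unfolding p_self by (subst sum.swap) (simp add: D_def)
    also have "\<dots> \<le> (\<Sum>s\<in>F. M\<^sup>2 * (\<Sum>j<n. (norm (x j s))\<^sup>2))"
      by (intro sum_mono T_bound)
    also have "\<dots> = M\<^sup>2 * p x x"
      unfolding p_self by (subst sum.swap) (simp add: sum_distrib_left)
    finally show ?thesis .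
  qed
  \<comment> \<open>The adjoint inherits the bound: \<open>p (E y) (E y)\<close> equals
    \<open>p (D (E y)) y\<close>, and after Cauchy-Schwarz one factor cancels.\<close>
  have p_E: "p (E y) (E y) \<le> M\<^sup>2 * p y y" for y
  proof (cases "p (E y) (E y) = 0")
    case True
    then show ?thesis using p_pos[of y] by simp
  next
    case False
    have "(p (E y) (E y))\<^sup>2 = (p (D (E y)) y)\<^sup>2" by (simp add: p_adj)
    also have "\<dots> \<le> p (D (E y)) (D (E y)) * p y y" by (rule p_CS)
    also have "\<dots> \<le> M\<^sup>2 * p (E y) (E y) * p y y" by (intro mult_right_mono p_D p_pos)
    finally show ?thesis
      using False p_pos[of "E y"] by (simp add: power2_eq_square mult_ac)
  qed
  define B where "B x = E (D x)" for x
  \<comment> \<open>E and D each contribute a factor M^2 to the squared norm, hence M^4 per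
    application of B.\<close>
  have p_B: "p ((B ^^ m) x) ((B ^^ m) x) \<le> (M ^ 4) ^ m * p x x" for m x
  proof (induction m)
    case (Suc m)
    have "p ((B ^^ Suc m) x) ((B ^^ Suc m) x) \<le> M\<^sup>2 * p (D ((B ^^ m) x)) (D ((B ^^ m) x))"
      by (simp add: B_def p_E)
    also have "\<dots> \<le> M\<^sup>2 * (M\<^sup>2 * p ((B ^^ m) x) ((B ^^ m) x))"
      by (intro mult_left_mono p_D) simp
    also have "\<dots> \<le> M\<^sup>2 * (M\<^sup>2 * ((M ^ 4) ^ m * p x x))"
      by (intro mult_left_mono Suc) simp_all
    also have "\<dots> = (M ^ 4) ^ Suc m * p x x"
      by (simp add: power2_eq_square power4_eq_xxxx mult_ac)
    finally show ?case .
  qed simp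
  \<comment> \<open>Crude comparison of the two forms; \<open>card F\<close> enters only the
    constant C of the growth hypothesis, which is independent of m.\<close>
  have q_p: "q x x \<le> card F * p x x" for x
  proof -
    have "(norm (U (x i)))\<^sup>2 \<le> card F * (\<Sum>s\<in>F. (norm (x i s))\<^sup>2)" for i
    proof -
      have "norm (U (x i)) \<le> (\<Sum>s\<in>F. norm (x i s))"
        unfolding U_def by (rule sum_norm_le) (simp add: norm_W)
      then have "(norm (U (x i)))\<^sup>2 \<le> (\<Sum>s\<in>F. norm (x i s))\<^sup>2"
        by (rule power_mono) simp
      also have "\<dots> \<le> (\<Sum>s\<in>F. (norm (x i s))\<^sup>2) * card F"
        by (rule sum_squared_le_sum_of_squares)
      finally show ?thesis by (simp add: mult.commute)
    qed
    then show ?thesis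
      unfolding q_self p_self sum_distrib_left by (intro sum_mono) (simp add: sum_distrib_left)
  qed
  have "q (B z) (B z) \<le> M ^ 4 * q z z"
  proof (rule symmetric_operator_bound[where q = q and C = "card F * p z z", OF q_CS q_pos])
    show "q (B x) y = q x (B y)" for x y
      unfolding B_def by (metis q_adj q_comm)
    show "q ((B ^^ m) z) ((B ^^ m) z) \<le> (card F * p z z) * (M ^ 4) ^ m" for m
      using order_trans[OF q_p mult_left_mono[OF p_B]] by (simp add: mult_ac)
  qed simp
  \<comment> \<open>Since \<open>q (D z) (D z) = q z (B z)\<close>, Cauchy-Schwarz turns the bound
    M^4 for B into M^2 for D.\<close>
  have "(q (D z) (D z))\<^sup>2 \<le> q z z * q (B z) (B z)"
    unfolding q_adj B_def[symmetric] by (rule q_CS)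
  also have "\<dots> \<le> q z z * (M ^ 4 * q z z)"
    by (intro mult_left_mono q_pos) fact
  also have "\<dots> = (M\<^sup>2 * q z z)\<^sup>2"
    by (simp add: power2_eq_square power4_eq_xxxx mult_ac)
  finally have "q (D z) (D z) \<le> M\<^sup>2 * q z z"
    by (rule power2_le_imp_le) (simp add: q_pos)
  then show ?thesis by (simp add: q_self U_def D_def)
qed

subsection \<open>The dilation\<close>

lemma imult_eq_scaleC: "imult x = scaleC \<i> x"
  and scaleR_eq_scaleC: "r *\<^sub>R x = scaleC (complex_of_real r) x"
  by (simp_all add: scaleC_def)

lemma cinner_diff_left: "cinner (x - y) z = cinner x z - cinner y z"
  by (simp add: complex_eq_iff inner_diff_left)

lemma Pythagoras:
  fixes x y :: "'a::real_inner"
  assumes "inner x y = 0"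
  shows "(norm (x + y))\<^sup>2 = (norm x)\<^sup>2 + (norm y)\<^sup>2"
  using assms by (simp add: power2_norm_eq_inner inner_add_left inner_add_right inner_commute)

locale naimark_dilation =
  fixes \<phi> :: "'g::group_add \<Rightarrow> 'h::complex_hilbert \<Rightarrow> 'h"
    and W :: "'g \<Rightarrow> 'h \<Rightarrow> 'k::complex_hilbert"
  assumes phi_bop: "bop (\<phi> s)"
    and phi_unital: "\<phi> 0 = id"
    and gram: "cinner (W t x) (W s y) = cinner (\<phi> (- s + t) x) y"
begin

lemma inner_W: "inner (W t x) (W s y) = inner (\<phi> (- s + t) x) y"
  using arg_cong[OF gram, of Re] by simp

lemma norm_W: "norm (W s x) = norm x"
  by (simp add: norm_eq_sqrt_inner inner_W phi_unital)

text \<open>The defect d is a combination of vectors of the family and, by the Gram relation,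
  orthogonal to all of them, hence to itself.\<close>

lemma W_add: "W s (x + y) = W s x + W s y"
proof -
  define d where "d = W s (x + y) - (W s x + W s y)"
  have "inner d (W t z) = 0" for t z
    using bop_linear[OF phi_bop]
    by (simp add: d_def inner_diff_left inner_add_left inner_W bounded_linear.linear linear_add)
  then have "inner d d = 0"
    by (subst (2) d_def) (simp add: inner_diff_right inner_add_right)
  then show ?thesis by (simp add: d_def)
qed

lemma W_scaleC: "W s (scaleC c x) = scaleC c (W s x)"
proof -
  define d where "d = W s (scaleC c x) - scaleC c (W s x)"
  have d: "cinner d (W t z) = 0" for t z
    by (simp add: d_def cinner_diff_left cinner_scaleC_left gram bop_scaleC[OF phi_bop])
  have "cinner d (scaleC c (W s x)) = 0"
    by (simp add: d cinner_scaleC_right)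
  then have "inner d (scaleC c (W s x)) = 0" by (metis Re_cinner zero_complex.sel(1))
  moreover have "inner d (W s (scaleC c x)) = 0" using d by (metis Re_cinner zero_complex.sel(1))
  ultimately have "inner d d = 0"
    by (subst (2) d_def) (simp add: inner_diff_right)
  then show ?thesis by (simp add: d_def)
qed

lemma bop_W: "bop (W s)"
  unfolding bop_def
  by (auto intro!: bounded_linear_intro[where K=1] simp: W_add norm_W scaleR_eq_scaleC W_scaleC imult_eq_scaleC)

lemmas bounded_linear_W = bop_linear[OF bop_W]

lemma W_imult: "W s (imult x) = imult (W s x)"
  by (simp add: imult_eq_scaleC W_scaleC)

definition core :: "'k set" where
  "core = {\<Sum>s\<in>F. W s (z s) |F z. finite F \<and> F \<subseteq> UNIV}"

text \<open>The real inner product suffices: the range of each \<open>W s\<close> is closed under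
  \<open>imult\<close>, so this is also the complex orthogonal complement.\<close>

definition perp :: "'k set" where
  "perp = {y. \<forall>s h. inner y (W s h) = 0}"

lemma subspace_core: "subspace core"
  unfolding core_def by (rule subspace_finite_sums) (rule bounded_linear.linear[OF bounded_linear_W])

lemma W_in_core: "W s h \<in> core"
  unfolding core_def by (auto intro!: exI[of _ "{s}"] exI[of _ "\<lambda>_. h"])

lemma sum_W_in_core: "finite F \<Longrightarrow> (\<Sum>s\<in>F. W (f s) (z s)) \<in> core"
  by (intro subspace_sum subspace_core W_in_core)

lemma subspace_perp: "subspace perp"
  by (auto simp: perp_def subspace_def inner_add_left)

lemma core_perp: "x \<in> core \<Longrightarrow> y \<in> perp \<Longrightarrow> inner x y = 0"
  by (auto simp: core_def perp_def inner_commute[of _ y] inner_sum_right)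

lemma imult_perp: "y \<in> perp \<Longrightarrow> imult y \<in> perp"
  by (simp add: perp_def inner_imult_left W_imult[symmetric])

text \<open>\<open>core\<close> is a mere algebraic span, so \<open>core\<close> plus
  \<open>perp\<close> may miss vectors. The projection of x onto the closure of \<open>core\<close>
  is approximated from \<open>core\<close> while the perpendicular part stays fixed.\<close>

lemma core_perp_dense: "closure {x + y |x y. x \<in> core \<and> y \<in> perp} = UNIV"
proof -
  have "x \<in> closure {x + y |x y. x \<in> core \<and> y \<in> perp}" for x
  proof -
    obtain v where v: "v \<in> closure core" "\<And>p. p \<in> core \<Longrightarrow> inner p (x - v) = 0"
      using orthogonal_projection[OF subspace_core] by blast
    have y: "x - v \<in> perp"
      using v(2)[OF W_in_core] by (simp add: perp_def inner_commute[of "x - v"])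
    from v(1) obtain f where f: "\<And>n. f n \<in> core" "f \<longlonglongrightarrow> v"
      unfolding closure_sequential by blast
    have "(\<lambda>n. f n + (x - v)) \<longlonglongrightarrow> v + (x - v)"
      by (intro tendsto_intros f)
    then show ?thesis
      unfolding closure_sequential
      by (intro exI[of _ "\<lambda>n. f n + (x - v)"]) (use f(1) y in auto)
  qed
  then show ?thesis by blast
qed

text \<open>The uniqueness principle behind the later operator identities: group law, linearity,
  covariance, reduction and multiplicativity are checked only on these two kinds of vector.\<close>

lemma bounded_linear_eqI:
  assumes S: "bounded_linear S" and T: "bounded_linear T"
    and W: "\<And>s h. S (W s h) = T (W s h)" and perp: "\<And>y. y \<in> perp \<Longrightarrow> S y = T y"
  shows "S = T"
proof
  fix x
  show "S x = T x"
  proof (rule bounded_linear_eq_on_closure[OF S T])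
    show "x \<in> closure {x + y |x y. x \<in> core \<and> y \<in> perp}"
      by (simp add: core_perp_dense)
    show "S v = T v" if "v \<in> {x + y |x y. x \<in> core \<and> y \<in> perp}" for v
    proof -
      from that obtain F z y where "v = (\<Sum>s\<in>F. W s (z s)) + y" "y \<in> perp"
        by (auto simp: core_def)
      then show ?thesis
        using S T W perp by (simp add: bounded_linear.linear linear_add linear_sum)
    qed
  qed
qed

text \<open>Common source of the unitaries (\<open>\<sigma> s = r + s\<close>,
  \<open>\<beta> s = id\<close>, \<open>C = \<epsilon> = 1\<close>) and of the lifted algebra
  (\<open>\<sigma> s = s\<close>, \<open>\<epsilon> = 0\<close>). Images of \<open>core\<close> and
  \<open>perp\<close> stay in \<open>core\<close> and \<open>perp\<close>, so Pythagoras combines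
  the two bounds.\<close>

lemma extension:
  fixes \<beta> :: "'g \<Rightarrow> 'h \<Rightarrow> 'h" and \<sigma> :: "'g \<Rightarrow> 'g"
  assumes \<beta>: "\<And>s. bop (\<beta> s)"
    and bound: "\<And>F z. finite F \<Longrightarrow>
      norm (\<Sum>s\<in>F. W (\<sigma> s) (\<beta> s (z s))) \<le> C * norm (\<Sum>s\<in>F. W s (z s))"
    and \<epsilon>: "\<bar>\<epsilon>\<bar> \<le> C"
  obtains T where "bop T" "\<And>s h. T (W s h) = W (\<sigma> s) (\<beta> s h)"
    "\<And>y. y \<in> perp \<Longrightarrow> T y = \<epsilon> *\<^sub>R y" "\<And>x. norm (T x) \<le> C * norm x"
proof -
  define L where "L s h = (W s h, W (\<sigma> s) (\<beta> s h))" for s h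
  have bW: "linear (W s)" "linear (\<beta> s)" for s
    using bounded_linear_W[of s] bop_linear[OF \<beta>[of s]] by (simp_all add: bounded_linear.linear)
  have L: "linear (L s)" for s
    by (rule linearI) (simp_all add: L_def linear_add[OF bW(1)] linear_add[OF bW(2)]
        linear_scale[OF bW(1)] linear_scale[OF bW(2)])
  define \<Gamma>1 where "\<Gamma>1 = {\<Sum>s\<in>F. L s (z s) |F z. finite F \<and> F \<subseteq> UNIV}"
  define \<Gamma>2 where "\<Gamma>2 = (\<lambda>y. (y, \<epsilon> *\<^sub>R y)) ` perp"
  define \<Gamma> where "\<Gamma> = {x + y |x y. x \<in> \<Gamma>1 \<and> y \<in> \<Gamma>2}"
  have 1: "subspace \<Gamma>1"
    unfolding \<Gamma>1_def by (rule subspace_finite_sums[OF L])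
  have "linear (\<lambda>y::'k. (y, \<epsilon> *\<^sub>R y))"
    by (rule linearI) (simp_all add: algebra_simps)
  then have 2: "subspace \<Gamma>2"
    unfolding \<Gamma>2_def using subspace_perp by (rule linear_subspace_image)
  have \<Gamma>: "subspace \<Gamma>"
    unfolding \<Gamma>_def using 1 2 by (rule subspace_sums)
  have elim: "\<exists>F z y. finite F \<and> y \<in> perp \<and> a = (\<Sum>s\<in>F. W s (z s)) + y \<and>
      b = (\<Sum>s\<in>F. W (\<sigma> s) (\<beta> s (z s))) + \<epsilon> *\<^sub>R y" if "(a, b) \<in> \<Gamma>" for a b
  proof -
    from that obtain g y where "g \<in> \<Gamma>1" and y: "y \<in> perp" and ab: "(a, b) = g + (y, \<epsilon> *\<^sub>R y)"
      unfolding \<Gamma>_def \<Gamma>2_def by blast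
    then obtain F z where "finite F" "g = (\<Sum>s\<in>F. L s (z s))"
      unfolding \<Gamma>1_def by blast
    with y ab have "finite F" "y \<in> perp" "(a, b) = (\<Sum>s\<in>F. L s (z s)) + (y, \<epsilon> *\<^sub>R y)"
      by simp_all
    moreover from this(3) have "a = (\<Sum>s\<in>F. W s (z s)) + y"
        "b = (\<Sum>s\<in>F. W (\<sigma> s) (\<beta> s (z s))) + \<epsilon> *\<^sub>R y"
      by (simp_all add: prod_eq_iff fst_sum snd_sum L_def)
    ultimately show ?thesis by blast
  qed
  have intro: "((\<Sum>s\<in>F. W s (z s)) + y, (\<Sum>s\<in>F. W (\<sigma> s) (\<beta> s (z s))) + \<epsilon> *\<^sub>R y) \<in> \<Gamma>"
    if "finite F" "y \<in> perp" for F z y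
  proof -
    have "(\<Sum>s\<in>F. L s (z s)) \<in> \<Gamma>1" "(y, \<epsilon> *\<^sub>R y) \<in> \<Gamma>2"
      using that by (auto simp: \<Gamma>1_def \<Gamma>2_def)
    then have "(\<Sum>s\<in>F. L s (z s)) + (y, \<epsilon> *\<^sub>R y) \<in> \<Gamma>"
      unfolding \<Gamma>_def by blast
    moreover have "(\<Sum>s\<in>F. L s (z s)) + (y, \<epsilon> *\<^sub>R y) =
        ((\<Sum>s\<in>F. W s (z s)) + y, (\<Sum>s\<in>F. W (\<sigma> s) (\<beta> s (z s))) + \<epsilon> *\<^sub>R y)"
      by (simp add: prod_eq_iff fst_sum snd_sum L_def)
    ultimately show ?thesis by simp
  qed
  have C: "0 \<le> C" using \<epsilon> by linarith
  have le: "norm b \<le> C * norm a" if ab: "(a, b) \<in> \<Gamma>" for a b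
  proof -
    from elim[OF ab] obtain F z y where F: "finite F" "y \<in> perp"
      and a: "a = (\<Sum>s\<in>F. W s (z s)) + y"
      and b: "b = (\<Sum>s\<in>F. W (\<sigma> s) (\<beta> s (z s))) + \<epsilon> *\<^sub>R y" by blast
    have "\<epsilon> *\<^sub>R y \<in> perp" using F(2) subspace_perp by (rule subspace_scale[rotated])
    then have "(norm b)\<^sup>2 = (norm (\<Sum>s\<in>F. W (\<sigma> s) (\<beta> s (z s))))\<^sup>2 + (norm (\<epsilon> *\<^sub>R y))\<^sup>2"
      unfolding b by (intro Pythagoras core_perp sum_W_in_core F)
    also have "\<dots> \<le> (C * norm (\<Sum>s\<in>F. W s (z s)))\<^sup>2 + (C * norm y)\<^sup>2"
      using \<epsilon> by (intro add_mono power_mono bound F) (simp_all add: mult_right_mono)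
    also have "\<dots> = C\<^sup>2 * ((norm (\<Sum>s\<in>F. W s (z s)))\<^sup>2 + (norm y)\<^sup>2)"
      by (simp add: power_mult_distrib algebra_simps)
    also have "\<dots> = (C * norm a)\<^sup>2"
      unfolding a power_mult_distrib
      by (subst Pythagoras) (intro core_perp sum_W_in_core[where f = "\<lambda>s. s"] F refl)+
    finally show ?thesis
      by (rule power2_le_imp_le) (simp add: C)
  qed
  have im: "(imult a, imult b) \<in> \<Gamma>" if ab: "(a, b) \<in> \<Gamma>" for a b
  proof -
    from elim[OF ab] obtain F z y where F: "finite F" "y \<in> perp"
      and a: "a = (\<Sum>s\<in>F. W s (z s)) + y"
      and b: "b = (\<Sum>s\<in>F. W (\<sigma> s) (\<beta> s (z s))) + \<epsilon> *\<^sub>R y" by blast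
    show ?thesis
      using intro[OF F(1) imult_perp[OF F(2)], of "\<lambda>s. imult (z s)"] \<beta>
      by (simp add: a b imult_add imult_sum imult_scaleR W_imult bop_def)
  qed
  have "{x + y |x y. x \<in> core \<and> y \<in> perp} \<subseteq> fst ` \<Gamma>"
    using intro unfolding core_def by (force simp: image_iff)
  then have dense: "closure (fst ` \<Gamma>) = UNIV"
    using closure_mono core_perp_dense by blast
  obtain T where T: "bop T" "\<And>x y. (x, y) \<in> \<Gamma> \<Longrightarrow> T x = y" "\<And>x. norm (T x) \<le> C * norm x"
    using bop_extension[OF \<Gamma> C le im dense] by metis
  show ?thesis
  proof (rule that[OF T(1) _ _ T(3)])
    show "T (W s h) = W (\<sigma> s) (\<beta> s h)" for s h
      using T(2)[OF intro[of "{s}" 0 "\<lambda>_. h"]] subspace_0[OF subspace_perp] by simp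
    show "T y = \<epsilon> *\<^sub>R y" if "y \<in> perp" for y
      using T(2)[OF intro[of "{}" y "\<lambda>_. 0"]] that by simp
  qed
qed

section \<open>Unitary translations on the dilation space\<close>

lemma translation_exists:
  "\<exists>T. bop T \<and> (\<forall>s h. T (W s h) = W (r + s) h) \<and> (\<forall>y\<in>perp. T y = y) \<and> (\<forall>x. norm (T x) \<le> norm x)"
proof -
  have "norm (\<Sum>s\<in>F. W (r + s) (id (z s))) \<le> 1 * norm (\<Sum>s\<in>F. W s (z s))" for F z
  proof -
    \<comment> \<open>The kernel depends on - s + t alone, so left translation by r preserves the
      norms of all sums.\<close>
    have eq: "- (r + s) + (r + t) = - s + t" for s t
      by (simp only: minus_add add.assoc minus_add_cancel)
    have "inner (\<Sum>s\<in>F. W (r + s) (z s)) (\<Sum>s\<in>F. W (r + s) (z s)) =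
        inner (\<Sum>s\<in>F. W s (z s)) (\<Sum>s\<in>F. W s (z s))"
      by (simp add: inner_sum_left inner_sum_right inner_W eq)
    then show ?thesis by (simp add: norm_eq_sqrt_inner)
  qed
  then show ?thesis
  proof (rule extension[of "\<lambda>_. id" "\<lambda>s. r + s" 1 1, OF bop_id])
    fix T
    assume "bop T" "\<And>s h. T (W s h) = W (r + s) (id h)"
      "\<And>y. y \<in> perp \<Longrightarrow> T y = 1 *\<^sub>R y" "\<And>x. norm (T x) \<le> 1 * norm x"
    then show ?thesis by (intro exI[of _ T]) simp
  qed simp
qed

definition trans :: "'g \<Rightarrow> 'k \<Rightarrow> 'k" where
  "trans r = (SOME T. bop T \<and> (\<forall>s h. T (W s h) = W (r + s) h) \<and> (\<forall>y\<in>perp. T y = y) \<and>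
     (\<forall>x. norm (T x) \<le> norm x))"

lemma bop_trans: "bop (trans r)"
  and trans_W: "trans r (W s h) = W (r + s) h"
  and trans_perp: "y \<in> perp \<Longrightarrow> trans r y = y"
  and norm_trans_le: "norm (trans r x) \<le> norm x"
  using someI_ex[OF translation_exists[of r]] unfolding trans_def[symmetric] by blast+

lemma trans_add: "trans (r + t) = trans r \<circ> trans t"
proof (rule bounded_linear_eqI)
  show "bounded_linear (trans (r + t))" "bounded_linear (trans r \<circ> trans t)"
    by (intro bop_linear bop_comp bop_trans)+
qed (simp_all add: trans_W trans_perp add.assoc)

lemma trans_0: "trans 0 = id"
proof (rule bounded_linear_eqI)
  show "bounded_linear (trans 0)" "bounded_linear (id :: 'k \<Rightarrow> 'k)"
    by (intro bop_linear bop_id bop_trans)+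
qed (simp_all add: trans_W trans_perp)

lemma trans_minus: "trans r (trans (- r) x) = x" "trans (- r) (trans r x) = x"
  using fun_cong[OF trans_add[of r "- r"], of x] fun_cong[OF trans_add[of "- r" r], of x]
  by (simp_all only: right_minus left_minus trans_0 comp_apply id_apply)

text \<open>A contraction with a contractive inverse is isometric.\<close>

lemma norm_trans: "norm (trans r x) = norm x"
proof (rule antisym[OF norm_trans_le])
  show "norm x \<le> norm (trans r x)"
    using norm_trans_le[of "- r" "trans r x"] by (simp only: trans_minus)
qed

lemma unitary_rep_trans: "unitary_rep trans"
proof -
  have "surj (trans r)" for r
    by (rule surjI[of _ "trans (- r)"]) (rule trans_minus)
  then have "unitary (trans r)" for r
    unfolding unitary_def isometry_def using bop_trans norm_trans by blast
  then show ?thesis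
    unfolding unitary_rep_def using trans_add trans_0 by blast
qed

text \<open>Serves twice: the translations compress to \<open>\<phi>\<close>, and the projection
  onto H sends \<open>W s h\<close> to \<open>W 0 (\<phi> s h)\<close>, on which reduction
  rests.\<close>

lemma adj_W0: "adj (W 0) (W s h) = \<phi> s h"
proof (rule adj_eqI[OF bounded_linear_W])
  fix x
  have "inner (W s h) (W 0 x) = inner (\<phi> s h) x"
    by (simp add: inner_W)
  then show "inner (W 0 x) (W s h) = inner x (\<phi> s h)"
    by (simp only: inner_commute)
qed

lemma adj_W0_perp: "y \<in> perp \<Longrightarrow> adj (W 0) y = 0"
proof (rule adj_eqI[OF bounded_linear_W])
  fix x assume "y \<in> perp"
  then have "inner y (W 0 x) = 0" by (simp add: perp_def)
  then show "inner (W 0 x) y = inner x 0" by (simp add: inner_commute)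
qed

end

section \<open>Strong continuity of the translations\<close>

locale continuous_naimark_dilation = naimark_dilation \<phi> W
  for \<phi> :: "'g::{group_add, t2_space} \<Rightarrow> 'h::complex_hilbert \<Rightarrow> 'h"
    and W :: "'g \<Rightarrow> 'h \<Rightarrow> 'k::complex_hilbert" +
  assumes group: "lc_group TYPE('g)"
    and phi_cont: "strongly_continuous \<phi>"
begin

text \<open>The squared distance is 2 |h|^2 - 2 <\<open>\<phi> u h\<close>, h> with u = - (r0 + s) +
  (r + s). As r tends to r0, u tends to 0, where \<open>\<phi>\<close> is the identity.\<close>

lemma tendsto_W: "((\<lambda>r. W (r + s) h) \<longlongrightarrow> W (r0 + s) h) (at r0)"
proof -
  have add: "continuous_on UNIV (\<lambda>p::'g \<times> 'g. fst p + snd p)"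
    using group by (simp add: lc_group_def)
  have c1: "continuous_on UNIV (\<lambda>r. r + s)"
    using continuous_on_compose2[OF add, of UNIV "\<lambda>r. (r, s)"] by (simp add: continuous_on_Pair continuous_on_id)
  have c2: "continuous_on UNIV (\<lambda>r. - (r0 + s) + (r + s))"
    using continuous_on_compose2[OF add continuous_on_Pair[OF continuous_on_const c1], of "- (r0 + s)"]
    by simp
  have "continuous_on UNIV (\<lambda>r. \<phi> (- (r0 + s) + (r + s)) h)"
    by (rule continuous_on_compose2[OF _ c2, of UNIV "\<lambda>g. \<phi> g h"])
       (use phi_cont in \<open>auto simp: strongly_continuous_def\<close>)
  then have "((\<lambda>r. \<phi> (- (r0 + s) + (r + s)) h) \<longlongrightarrow> \<phi> (- (r0 + s) + (r0 + s)) h) (at r0)"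
    unfolding continuous_on_def by (rule bspec) simp
  then have lim: "((\<lambda>r. \<phi> (- (r0 + s) + (r + s)) h) \<longlongrightarrow> h) (at r0)"
    by (simp only: left_minus phi_unital id_apply)
  have "(norm (W (r + s) h - W (r0 + s) h))\<^sup>2 =
      2 * (norm h)\<^sup>2 - 2 * inner (\<phi> (- (r0 + s) + (r + s)) h) h" for r
  proof -
    have "(norm (W (r + s) h - W (r0 + s) h))\<^sup>2 = (norm (W (r + s) h))\<^sup>2 + (norm (W (r0 + s) h))\<^sup>2 -
        2 * inner (W (r + s) h) (W (r0 + s) h)"
      by (simp add: power2_norm_eq_inner inner_diff_left inner_diff_right inner_commute)
    then show ?thesis by (simp only: norm_W inner_W mult_2)
  qed
  moreover have "((\<lambda>r. 2 * (norm h)\<^sup>2 - 2 * inner (\<phi> (- (r0 + s) + (r + s)) h) h) \<longlongrightarrow>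
      2 * (norm h)\<^sup>2 - 2 * inner h h) (at r0)"
    by (intro tendsto_intros lim)
  moreover have "2 * (norm h)\<^sup>2 - 2 * inner h h = 0"
    by (simp add: power2_norm_eq_inner)
  ultimately have "((\<lambda>r. (norm (W (r + s) h - W (r0 + s) h))\<^sup>2) \<longlongrightarrow> 0) (at r0)"
    by simp
  then have "((\<lambda>r. sqrt ((norm (W (r + s) h - W (r0 + s) h))\<^sup>2)) \<longlongrightarrow> sqrt 0) (at r0)"
    by (rule tendsto_real_sqrt)
  then have "((\<lambda>r. norm (W (r + s) h - W (r0 + s) h)) \<longlongrightarrow> 0) (at r0)"
    by simp
  then show ?thesis
    by (rule LIM_zero_cancel[OF tendsto_norm_zero_cancel])
qed

text \<open>On \<open>core\<close> plus \<open>perp\<close> the orbit of a vector is a finite sum of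
  continuous orbits. Since every \<open>trans r\<close> is isometric, an epsilon/3 argument carries
  this to the closure.\<close>

lemma strongly_continuous_trans: "strongly_continuous trans"
proof -
  have "((\<lambda>r. trans r x) \<longlongrightarrow> trans r0 x) (at r0)" for x r0
  proof (rule tendstoI)
    fix \<epsilon> :: real assume \<epsilon>: "0 < \<epsilon>"
    have "x \<in> closure {x + y |x y. x \<in> core \<and> y \<in> perp}"
      by (simp add: core_perp_dense)
    then have "\<exists>v\<in>{x + y |x y. x \<in> core \<and> y \<in> perp}. dist v x < \<epsilon> / 3"
      by (rule closure_approachable[THEN iffD1, rule_format]) (use \<epsilon> in simp)
    then obtain v where v: "v \<in> {x + y |x y. x \<in> core \<and> y \<in> perp}" "dist v x < \<epsilon> / 3"
      by (rule bexE)
    from v(1) obtain F z y where F: "v = (\<Sum>s\<in>F. W s (z s)) + y" "y \<in> perp"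
      by (auto simp: core_def)
    have tv: "trans r v = (\<Sum>s\<in>F. W (r + s) (z s)) + y" for r
      using bop_linear[OF bop_trans[of r]] F(2)
      by (simp add: F(1) bounded_linear.linear linear_add linear_sum trans_W trans_perp)
    have "((\<lambda>r. trans r v) \<longlongrightarrow> trans r0 v) (at r0)"
      unfolding tv by (intro tendsto_add tendsto_sum tendsto_W tendsto_const)
    then have "\<forall>\<^sub>F r in at r0. dist (trans r v) (trans r0 v) < \<epsilon> / 3"
      using \<epsilon> by (intro tendstoD) simp_all
    then show "\<forall>\<^sub>F r in at r0. dist (trans r x) (trans r0 x) < \<epsilon>"
    proof eventually_elim
      case (elim r)
      have "dist (trans t x) (trans t v) = dist v x" for t
        using bop_linear[OF bop_trans[of t]] norm_trans[of t "x - v"]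
        by (simp add: dist_norm bounded_linear.linear linear_diff norm_minus_commute)
      from this[of r] this[of r0] elim v(2) show ?case
        using dist_triangle[of "trans r x" "trans r0 x" "trans r v"]
          dist_triangle[of "trans r v" "trans r0 x" "trans r0 v"] dist_commute[of "trans r0 v" "trans r0 x"]
        by linarith
    qed
  qed
  then show ?thesis
    by (simp add: strongly_continuous_def continuous_on_def)
qed

end

section \<open>Lifting the operator algebra to the dilation space\<close>

locale covariant_naimark_dilation = naimark_dilation \<phi> W
  for \<phi> :: "'g::{group_add, t2_space} \<Rightarrow> 'h::complex_hilbert \<Rightarrow> 'h"
    and W :: "'g \<Rightarrow> 'h \<Rightarrow> 'k::complex_hilbert" +
  fixes A :: "('a::complex_hilbert \<Rightarrow> 'a) set"
    and \<alpha> :: "'g \<Rightarrow> ('a \<Rightarrow> 'a) \<Rightarrow> ('a \<Rightarrow> 'a)"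
    and \<rho> :: "('a \<Rightarrow> 'a) \<Rightarrow> 'h \<Rightarrow> 'h"
  assumes dyn: "dynamical_system A \<alpha>"
    and rho_cc: "ccontractive A \<rho>"
    and covariant: "a \<in> A \<Longrightarrow> \<phi> s \<circ> \<rho> a = \<rho> (\<alpha> s a) \<circ> \<phi> s"
begin

lemma ci_alpha: "ci_automorphism A (\<alpha> s)"
  and alpha_add: "a \<in> A \<Longrightarrow> \<alpha> (s + t) a = \<alpha> s (\<alpha> t a)"
  and alpha_0: "a \<in> A \<Longrightarrow> \<alpha> 0 a = a"
  and bop_A: "a \<in> A \<Longrightarrow> bop a"
  and A_add: "a \<in> A \<Longrightarrow> b \<in> A \<Longrightarrow> (\<lambda>x. a x + b x) \<in> A"
  and A_comp: "a \<in> A \<Longrightarrow> b \<in> A \<Longrightarrow> a \<circ> b \<in> A"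
  and A_scaleC: "a \<in> A \<Longrightarrow> (\<lambda>x. scaleC c (a x)) \<in> A"
  using dyn unfolding dynamical_system_def operator_algebra_def by blast+

lemma alpha_A: "a \<in> A \<Longrightarrow> \<alpha> s a \<in> A"
  using ci_alpha[of s] bij_betwE[of "\<alpha> s" A A] unfolding ci_automorphism_def by blast

lemma bop_rho: "a \<in> A \<Longrightarrow> bop (\<rho> a)"
  using rho_cc by (simp add: ccontractive_def)

text \<open>Covariance at the group element - s + t, applied to \<open>\<alpha> (- t) a\<close>: the
  twists compose to - s. This is the commutation with the Gram operator; its case s = 0 gives
  reduction.\<close>

lemma rho_intertwines:
  assumes a: "a \<in> A"
  shows "\<phi> (- s + t) (\<rho> (\<alpha> (- t) a) x) = \<rho> (\<alpha> (- s) a) (\<phi> (- s + t) x)"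
proof -
  have "\<alpha> (- s + t) (\<alpha> (- t) a) = \<alpha> (- s + t + - t) a"
    by (rule alpha_add[OF a, symmetric])
  also have "- s + t + - t = - s" by (simp only: add.assoc right_minus add_0_right)
  finally have "\<alpha> (- s + t) (\<alpha> (- t) a) = \<alpha> (- s) a" .
  with fun_cong[OF covariant[OF alpha_A[OF a], of "- s + t" "- t"], of x] show ?thesis
    by (simp only: comp_apply)
qed

text \<open>The block at any s has norm at most that of a, because \<open>\<alpha>\<close> is
  completely isometric and \<open>\<rho>\<close> completely contractive;
  \<open>gram_contraction\<close> needs this uniformity in s.\<close>

lemma matrix_bound:
  assumes a: "\<And>i j. i < n \<Longrightarrow> j < n \<Longrightarrow> a i j \<in> A" and F: "finite F"
  shows "(\<Sum>i<n. (norm (\<Sum>s\<in>F. W s (\<Sum>j<n. \<rho> (\<alpha> (- s) (a i j)) (z j s))))\<^sup>2) \<le>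
    (mnorm n a)\<^sup>2 * (\<Sum>j<n. (norm (\<Sum>s\<in>F. W s (z j s)))\<^sup>2)"
proof (rule gram_contraction[OF bounded_linear_W norm_W _ _ _ F])
  show bl: "bounded_linear (\<rho> (\<alpha> (- s) (a i j)))" if "i < n" "j < n" for s i j
    using that by (intro bop_linear bop_rho alpha_A a)
  show "inner (W t (\<rho> (\<alpha> (- t) (a i j)) x)) (W s y) =
      inner (W t x) (W s (adj (\<rho> (\<alpha> (- s) (a i j))) y))" if "i < n" "j < n" for s t i j x y
    using that by (simp only: inner_W inner_adj[OF bl] rho_intertwines a)
  fix s :: 'g and x :: "nat \<Rightarrow> 'h"
  let ?T = "\<lambda>i j. \<rho> (\<alpha> (- s) (a i j))"
  have "mnorm n ?T \<le> mnorm n (\<lambda>i j. \<alpha> (- s) (a i j))"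
    using rho_cc alpha_A a unfolding ccontractive_def by simp
  also have "\<dots> = mnorm n a"
    using ci_alpha[of "- s"] a unfolding ci_automorphism_def by simp
  finally have "(mnorm n ?T)\<^sup>2 \<le> (mnorm n a)\<^sup>2"
    using bl by (intro power_mono mnorm_nonneg)
  then have "(mnorm n ?T)\<^sup>2 * (\<Sum>j<n. (norm (x j))\<^sup>2) \<le> (mnorm n a)\<^sup>2 * (\<Sum>j<n. (norm (x j))\<^sup>2)"
    by (intro mult_right_mono sum_nonneg) simp_all
  with mnorm_bound[of n ?T x] bl
  show "(\<Sum>i<n. (norm (\<Sum>j<n. \<rho> (\<alpha> (- s) (a i j)) (x j)))\<^sup>2) \<le> (mnorm n a)\<^sup>2 * (\<Sum>j<n. (norm (x j))\<^sup>2)"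
    by (meson order_trans)
qed

lemma lift_exists:
  assumes a: "a \<in> A"
  shows "\<exists>T. bop T \<and> (\<forall>s h. T (W s h) = W s (\<rho> (\<alpha> (- s) a) h)) \<and> (\<forall>y\<in>perp. T y = 0)"
proof -
  let ?C = "mnorm 1 (\<lambda>_ _. a)"
  have C: "0 \<le> ?C"
    using a by (intro mnorm_nonneg bop_linear bop_A)
  have "norm (\<Sum>s\<in>F. W s (\<rho> (\<alpha> (- s) a) (z s))) \<le> ?C * norm (\<Sum>s\<in>F. W s (z s))" if "finite F" for F z
  proof (rule power2_le_imp_le)
    show "(norm (\<Sum>s\<in>F. W s (\<rho> (\<alpha> (- s) a) (z s))))\<^sup>2 \<le> (?C * norm (\<Sum>s\<in>F. W s (z s)))\<^sup>2"
      using matrix_bound[of 1 "\<lambda>_ _. a" F "\<lambda>_. z"] a that by (simp add: power_mult_distrib)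
  qed (intro mult_nonneg_nonneg C norm_ge_zero)
  then show ?thesis
  proof (rule extension[of "\<lambda>s. \<rho> (\<alpha> (- s) a)" "\<lambda>s. s" ?C 0, OF bop_rho[OF alpha_A[OF a]]])
    fix T
    assume "bop T" "\<And>s h. T (W s h) = W s (\<rho> (\<alpha> (- s) a) h)"
      "\<And>y. y \<in> perp \<Longrightarrow> T y = 0 *\<^sub>R y"
    then show ?thesis by (intro exI[of _ T]) simp
  next
    show "\<bar>0\<bar> \<le> ?C" unfolding abs_zero by (rule C)
  qed
qed

definition lift :: "('a \<Rightarrow> 'a) \<Rightarrow> 'k \<Rightarrow> 'k" where
  "lift a = (SOME T. bop T \<and> (\<forall>s h. T (W s h) = W s (\<rho> (\<alpha> (- s) a) h)) \<and> (\<forall>y\<in>perp. T y = 0))"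

lemma bop_lift: "a \<in> A \<Longrightarrow> bop (lift a)"
  and lift_W: "a \<in> A \<Longrightarrow> lift a (W s h) = W s (\<rho> (\<alpha> (- s) a) h)"
  and lift_perp: "a \<in> A \<Longrightarrow> y \<in> perp \<Longrightarrow> lift a y = 0"
  using someI_ex[OF lift_exists[of a]] unfolding lift_def[symmetric] by blast+

lemmas bounded_linear_lift = bop_linear[OF bop_lift]

lemma lift_add: "a \<in> A \<Longrightarrow> b \<in> A \<Longrightarrow> lift (\<lambda>x. a x + b x) = (\<lambda>x. lift a x + lift b x)"
proof (rule bounded_linear_eqI)
  assume ab: "a \<in> A" "b \<in> A"
  show "bounded_linear (lift (\<lambda>x. a x + b x))" "bounded_linear (\<lambda>x. lift a x + lift b x)"
    by (intro bounded_linear_add bounded_linear_lift A_add ab)+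
  have "\<rho> (\<alpha> s (\<lambda>x. a x + b x)) = (\<lambda>x. \<rho> (\<alpha> s a) x + \<rho> (\<alpha> s b) x)" for s
    using ci_alpha[of s] rho_cc ab alpha_A[of a s] alpha_A[of b s]
    unfolding ci_automorphism_def ccontractive_def linear_on_def by simp
  then show "lift (\<lambda>x. a x + b x) (W s h) = lift a (W s h) + lift b (W s h)" for s h
    using ab by (simp add: lift_W A_add W_add)
  show "lift (\<lambda>x. a x + b x) y = lift a y + lift b y" if "y \<in> perp" for y
    using ab that by (simp add: lift_perp A_add)
qed

lemma lift_scaleC: "a \<in> A \<Longrightarrow> lift (\<lambda>x. scaleC c (a x)) = (\<lambda>x. scaleC c (lift a x))"
proof (rule bounded_linear_eqI)
  assume a: "a \<in> A"
  show "bounded_linear (lift (\<lambda>x. scaleC c (a x)))" "bounded_linear (\<lambda>x. scaleC c (lift a x))"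
    by (intro bop_linear bop_scaleC_fun bop_lift A_scaleC a)+
  have "\<rho> (\<alpha> s (\<lambda>x. scaleC c (a x))) = (\<lambda>x. scaleC c (\<rho> (\<alpha> s a) x))" for s
    using ci_alpha[of s] rho_cc a alpha_A[of a s]
    unfolding ci_automorphism_def ccontractive_def linear_on_def by simp
  then show "lift (\<lambda>x. scaleC c (a x)) (W s h) = scaleC c (lift a (W s h))" for s h
    using a by (simp add: lift_W A_scaleC W_scaleC)
  show "lift (\<lambda>x. scaleC c (a x)) y = scaleC c (lift a y)" if "y \<in> perp" for y
    using a that by (simp add: lift_perp A_scaleC) (simp add: scaleC_def)
qed

lemma lift_bound_dense:
  assumes a: "\<And>i j. i < n \<Longrightarrow> j < n \<Longrightarrow> a i j \<in> A"
    and k: "\<And>j. k j \<in> {x + y |x y. x \<in> core \<and> y \<in> perp}"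
  shows "(\<Sum>i<n. (norm (\<Sum>j<n. lift (a i j) (k j)))\<^sup>2) \<le> (mnorm n a)\<^sup>2 * (\<Sum>j<n. (norm (k j))\<^sup>2)"
proof -
  have "\<exists>F z y. finite F \<and> y \<in> perp \<and> k j = (\<Sum>s\<in>F. W s (z s)) + y" for j
    using k[of j] unfolding core_def by auto
  then obtain F z y where F: "\<And>j. finite (F j)" and y: "\<And>j. y j \<in> perp"
    and kj: "\<And>j. k j = (\<Sum>s\<in>F j. W s (z j s)) + y j"
    by metis
  \<comment> \<open>The vectors \<open>k j\<close> come with different finite supports; over the
    union, padded by 0, they share one index set.\<close>
  define F' where "F' = (\<Union>j<n. F j)"
  define z' where "z' j s = (if s \<in> F j then z j s else 0)" for j s
  have F': "finite F'" using F by (simp add: F'_def)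
  have W0: "W s 0 = 0" for s
    using linear_0[OF bounded_linear.linear[OF bounded_linear_W]] .
  have kj': "k j = (\<Sum>s\<in>F'. W s (z' j s)) + y j" if "j < n" for j
    unfolding kj using that F'
    by (auto intro!: sum.mono_neutral_cong_left simp: F'_def z'_def W0)
  have "(\<Sum>j<n. lift (a i j) (k j)) = (\<Sum>s\<in>F'. W s (\<Sum>j<n. \<rho> (\<alpha> (- s) (a i j)) (z' j s)))"
    if i: "i < n" for i
  proof -
    have "lift (a i j) (k j) = (\<Sum>s\<in>F'. W s (\<rho> (\<alpha> (- s) (a i j)) (z' j s)))" if "j < n" for j
      unfolding kj'[OF that] using bounded_linear_lift[OF a[OF i that]] y a[OF i that]
      by (simp add: bounded_linear.linear linear_add linear_sum lift_W lift_perp)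
    then have "(\<Sum>j<n. lift (a i j) (k j)) = (\<Sum>j<n. \<Sum>s\<in>F'. W s (\<rho> (\<alpha> (- s) (a i j)) (z' j s)))"
      by simp
    also have "\<dots> = (\<Sum>s\<in>F'. \<Sum>j<n. W s (\<rho> (\<alpha> (- s) (a i j)) (z' j s)))"
      by (rule sum.swap)
    finally show ?thesis
      by (simp add: linear_sum[OF bounded_linear.linear[OF bounded_linear_W]])
  qed
  then have "(\<Sum>i<n. (norm (\<Sum>j<n. lift (a i j) (k j)))\<^sup>2) =
      (\<Sum>i<n. (norm (\<Sum>s\<in>F'. W s (\<Sum>j<n. \<rho> (\<alpha> (- s) (a i j)) (z' j s))))\<^sup>2)"
    by simp
  also have "\<dots> \<le> (mnorm n a)\<^sup>2 * (\<Sum>j<n. (norm (\<Sum>s\<in>F'. W s (z' j s)))\<^sup>2)"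
    using a F' by (rule matrix_bound)
  \<comment> \<open>The lift has killed the parts \<open>y j\<close> in \<open>perp\<close>;
    restoring them on the right only increases the norms.\<close>
  also have "\<dots> \<le> (mnorm n a)\<^sup>2 * (\<Sum>j<n. (norm (k j))\<^sup>2)"
  proof (intro mult_left_mono sum_mono)
    fix j assume "j \<in> {..<n}"
    then have "(norm (k j))\<^sup>2 = (norm (\<Sum>s\<in>F'. W s (z' j s)))\<^sup>2 + (norm (y j))\<^sup>2"
      by (simp add: kj' Pythagoras core_perp sum_W_in_core[where f = "\<lambda>s. s"] F' y)
    then show "(norm (\<Sum>s\<in>F'. W s (z' j s)))\<^sup>2 \<le> (norm (k j))\<^sup>2" by simp
  qed simp
  finally show ?thesis .
qed

text \<open>The matrix inequality is known on a dense set of tuples, and both sides are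
  continuous.\<close>

lemma ccontractive_lift: "ccontractive A lift"
proof -
  have "mnorm n (\<lambda>i j. lift (a i j)) \<le> mnorm n a" if "\<forall>i<n. \<forall>j<n. a i j \<in> A" for n a
  proof (rule mnorm_leI)
    have a: "a i j \<in> A" if "i < n" "j < n" for i j
      using \<open>\<forall>i<n. \<forall>j<n. a i j \<in> A\<close> that by blast
    show "0 \<le> mnorm n a"
      by (intro mnorm_nonneg bop_linear bop_A a)
    fix k :: "nat \<Rightarrow> 'k"
    have "k j \<in> closure {x + y |x y. x \<in> core \<and> y \<in> perp}" for j
      by (simp add: core_perp_dense)
    then have "\<forall>j. \<exists>f. (\<forall>m. f m \<in> {x + y |x y. x \<in> core \<and> y \<in> perp}) \<and> f \<longlonglongrightarrow> k j"
      unfolding closure_sequential by (rule allI)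
    then obtain f where fk: "\<forall>j. (\<forall>m. f j m \<in> {x + y |x y. x \<in> core \<and> y \<in> perp}) \<and> f j \<longlonglongrightarrow> k j"
      by (rule choice[THEN exE])
    have f: "f j m \<in> {x + y |x y. x \<in> core \<and> y \<in> perp}" and lim: "f j \<longlonglongrightarrow> k j" for j m
      using spec[OF fk, of j] by (elim conjE spec, elim conjE)
    show "(\<Sum>i<n. (norm (\<Sum>j<n. lift (a i j) (k j)))\<^sup>2) \<le> (mnorm n a)\<^sup>2 * (\<Sum>j<n. (norm (k j))\<^sup>2)"
    proof (rule LIMSEQ_le)
      show "(\<lambda>m. \<Sum>i<n. (norm (\<Sum>j<n. lift (a i j) (f j m)))\<^sup>2) \<longlonglongrightarrow>
          (\<Sum>i<n. (norm (\<Sum>j<n. lift (a i j) (k j)))\<^sup>2)"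
        by (intro tendsto_sum tendsto_power tendsto_norm bounded_linear.tendsto[OF bounded_linear_lift] a lim) auto
      show "(\<lambda>m. (mnorm n a)\<^sup>2 * (\<Sum>j<n. (norm (f j m))\<^sup>2)) \<longlonglongrightarrow> (mnorm n a)\<^sup>2 * (\<Sum>j<n. (norm (k j))\<^sup>2)"
        by (intro tendsto_intros lim)
      show "\<exists>N. \<forall>m\<ge>N. (\<Sum>i<n. (norm (\<Sum>j<n. lift (a i j) (f j m)))\<^sup>2) \<le>
          (mnorm n a)\<^sup>2 * (\<Sum>j<n. (norm (f j m))\<^sup>2)"
        by (intro exI[of _ 0] allI impI lift_bound_dense a f)
    qed
  qed
  then show ?thesis
    unfolding ccontractive_def linear_on_def by (simp add: bop_lift lift_add lift_scaleC)
qed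

lemma lift_W0: "a \<in> A \<Longrightarrow> lift a (W 0 h) = W 0 (\<rho> a h)"
  by (simp add: lift_W alpha_0)

lemma compress_lift:
  assumes a: "a \<in> A"
  shows "compress (W 0) (lift a) = \<rho> a"
  unfolding compress_def using a by (simp add: fun_eq_iff lift_W0 adj_W0 phi_unital)

lemma trans_lift:
  assumes a: "a \<in> A"
  shows "trans r \<circ> lift a = lift (\<alpha> r a) \<circ> trans r"
proof (rule bounded_linear_eqI)
  note ra = alpha_A[OF a, of r]
  show "bounded_linear (trans r \<circ> lift a)" "bounded_linear (lift (\<alpha> r a) \<circ> trans r)"
    by (intro bop_linear bop_comp bop_trans bop_lift a ra)+
  \<comment> \<open>On \<open>W s h\<close> both sides land in the range of
    \<open>W (r + s)\<close>; the twist there undoes \<open>\<alpha> r\<close>.\<close>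
  have "\<alpha> (- (r + s)) (\<alpha> r a) = \<alpha> (- s) a" for s
    unfolding alpha_add[OF a, symmetric] by (simp only: minus_add add.assoc left_minus add_0_right)
  then show "(trans r \<circ> lift a) (W s h) = (lift (\<alpha> r a) \<circ> trans r) (W s h)" for s h
    using a ra by (simp add: lift_W trans_W del: minus_add)
  show "(trans r \<circ> lift a) y = (lift (\<alpha> r a) \<circ> trans r) y" if "y \<in> perp" for y
    using a ra that linear_0[OF bounded_linear.linear[OF bop_linear[OF bop_trans]]]
    by (simp add: lift_perp trans_perp)
qed

text \<open>On \<open>W s h\<close>, commuting the projection with the lift means \<open>\<phi> s
  (\<rho> (\<alpha> (- s) a) h) = \<rho> a (\<phi> s h)\<close>, an instance of covariance. On
  \<open>perp\<close> both sides vanish.\<close>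

lemma reduces_lift:
  assumes a: "a \<in> A"
  shows "reduces (W 0) (lift a)"
  unfolding reduces_def
proof (rule bounded_linear_eqI)
  have P: "bounded_linear (W 0 \<circ> adj (W 0))"
    unfolding comp_def by (intro bounded_linear_compose[OF bounded_linear_W bounded_linear_adj] bounded_linear_W)
  show "bounded_linear (W 0 \<circ> adj (W 0) \<circ> lift a)" "bounded_linear (lift a \<circ> (W 0 \<circ> adj (W 0)))"
    using bounded_linear_compose[OF P bounded_linear_lift[OF a]]
      bounded_linear_compose[OF bounded_linear_lift[OF a] P] by (simp_all add: comp_def)
  show "(W 0 \<circ> adj (W 0) \<circ> lift a) (W s h) = (lift a \<circ> (W 0 \<circ> adj (W 0))) (W s h)" for s h
    using a rho_intertwines[OF a, of 0 s h] by (simp add: lift_W adj_W0 alpha_0)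
  show "(W 0 \<circ> adj (W 0) \<circ> lift a) y = (lift a \<circ> (W 0 \<circ> adj (W 0))) y" if "y \<in> perp" for y
    using that a linear_0[OF bounded_linear.linear[OF bounded_linear_W[of 0]]]
      linear_0[OF bounded_linear.linear[OF bounded_linear_lift[OF a]]]
      linear_0[OF bounded_linear.linear[OF bounded_linear_adj[OF bounded_linear_W[of 0]]]]
    by (simp add: lift_perp adj_W0_perp)
qed

text \<open>The lift maps the range of each \<open>W s\<close> to itself, acting there through
  \<open>\<rho>\<close> after \<open>\<alpha> (- s)\<close>, both multiplicative.\<close>

lemma multiplicative_lift:
  assumes mult: "multiplicative_on A \<rho>"
  shows "multiplicative_on A lift"
  unfolding multiplicative_on_def
proof (intro ballI)
  fix a b assume ab: "a \<in> A" "b \<in> A"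
  show "lift (a \<circ> b) = lift a \<circ> lift b"
  proof (rule bounded_linear_eqI)
    show "bounded_linear (lift (a \<circ> b))" "bounded_linear (lift a \<circ> lift b)"
      by (intro bop_linear bop_comp bop_lift A_comp ab)+
    have "\<rho> (\<alpha> s (a \<circ> b)) = \<rho> (\<alpha> s a) \<circ> \<rho> (\<alpha> s b)" for s
      using ci_alpha[of s] mult ab alpha_A[of a s] alpha_A[of b s]
      unfolding ci_automorphism_def multiplicative_on_def by simp
    then show "lift (a \<circ> b) (W s h) = (lift a \<circ> lift b) (W s h)" for s h
      using ab by (simp add: lift_W A_comp)
    show "lift (a \<circ> b) y = (lift a \<circ> lift b) y" if "y \<in> perp" for y
      using that ab linear_0[OF bounded_linear.linear[OF bounded_linear_lift[of a]]]
      by (simp add: lift_perp A_comp)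
  qed
qed

end

theorem theorem3p20:
  fixes A :: "('a::complex_hilbert \<Rightarrow> 'a) set"
    and \<alpha> :: "'g::{group_add, t2_space} \<Rightarrow> ('a \<Rightarrow> 'a) \<Rightarrow> ('a \<Rightarrow> 'a)"
    and \<phi> :: "'g \<Rightarrow> 'h::complex_hilbert \<Rightarrow> 'h"
    and \<rho> :: "('a \<Rightarrow> 'a) \<Rightarrow> 'h \<Rightarrow> 'h"
  assumes G: "lc_group TYPE('g)"
    and dyn: "dynamical_system A \<alpha>"
    and unital_A: "id \<in> A"
    and phi_bop: "\<forall>s. bop (\<phi> s)"
    and phi_unital: "\<phi> 0 = id"
    and phi_cont: "strongly_continuous \<phi>"
    and phi_cpd: "cpd \<phi>"
    and rho_cc: "ccontractive A \<rho>"
    and rho_unital: "\<rho> id = id"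
    and covariant: "\<forall>s. \<forall>a\<in>A. \<phi> s \<circ> \<rho> a = \<rho> (\<alpha> s a) \<circ> \<phi> s"
    and room: "\<exists>e :: 'g \<times> 'h \<Rightarrow> 'k::complex_hilbert. orthonormal_family e"
  shows "\<exists>(V :: 'h \<Rightarrow> 'k) (\<phi>' :: 'g \<Rightarrow> 'k \<Rightarrow> 'k) (\<rho>' :: ('a \<Rightarrow> 'a) \<Rightarrow> 'k \<Rightarrow> 'k).
           isometry V \<and> unitary_rep \<phi>' \<and> strongly_continuous \<phi>' \<and> ccontractive A \<rho>' \<and>
           (\<forall>a\<in>A. \<rho> a = compress V (\<rho>' a)) \<and>
           (\<forall>s. \<phi> s = compress V (\<phi>' s)) \<and>
           (\<forall>s. \<forall>a\<in>A. \<phi>' s \<circ> \<rho>' a = \<rho>' (\<alpha> s a) \<circ> \<phi>' s) \<and>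
           (\<forall>a\<in>A. reduces V (\<rho>' a)) \<and>
           (multiplicative_on A \<rho> \<longrightarrow> multiplicative_on A \<rho>')"
proof -
  obtain e :: "'g \<times> 'h \<Rightarrow> 'k" where e: "orthonormal_family e"
    using room by blast
  obtain W :: "'g \<Rightarrow> 'h \<Rightarrow> 'k" where W: "\<And>s t x y. cinner (W t x) (W s y) = cinner (\<phi> (- s + t) x) y"
    using phi_cpd phi_bop phi_unital e by (metis naimark_family)
  interpret continuous_naimark_dilation \<phi> W
    by unfold_locales (use phi_bop phi_unital W G phi_cont in auto)
  interpret covariant_naimark_dilation \<phi> W A \<alpha> \<rho>
    by unfold_locales (use dyn rho_cc covariant in auto)
  have "isometry (W 0)"
    by (simp add: isometry_def bop_W norm_W)
  moreover have "\<phi> s = compress (W 0) (trans s)" for s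
    by (simp add: compress_def fun_eq_iff trans_W adj_W0)
  ultimately show ?thesis
    using unitary_rep_trans strongly_continuous_trans ccontractive_lift
      compress_lift trans_lift reduces_lift multiplicative_lift
    by (intro exI[of _ "W 0"] exI[of _ trans] exI[of _ lift]) simp
qed

end
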